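(* There is an absolute constant $c>0$ such that for any integers $n\ge k\ge 1$, any convex body $K$ in $\mathbb{R}^n$ whose centroid is at the origin, any $(n-k)$-dimensional linear subspace $F$ of $\mathbb{R}^n$, and any $\theta\in S^{n-1}\cap F^\perp$, we have $$\frac{|K\cap(F+\mathbb{R}_+\theta)|_{n-k+1}}{|K\cap(F+\mathbb{R}_-\theta)|_{n-k+1}}\le c\,k^2\left(1+\frac{k}{n-k+1}\right)^{n-k-1}\le c\left(\frac{k(n+1-k)}{n+1}\right)^2 e^k.$$
   Context: A convex body is a compact convex set with nonempty interior; its centroid is $\frac{1}{|K|}\int_K x\,dx$. $|\cdot|_d$ denotes $d$-dimensional volume. $\mathbb{R}_+\theta=\{t\theta:t\ge0\}$, $\mathbb{R}_-\theta=\{t\theta:t\le0\}$, and $F+A=\{x+y:x\in F,\ y\in A\}$. *)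

theory Defs
  imports "HOL-Analysis.Analysis"
begin

text \<open>
  The constant of the theorem must not depend on the dimension, so the dimension cannot be a
  type.  All spaces \<open>\<real>\<^sup>n\<close> are therefore realised inside one type: the inner product space of
  finitely supported real sequences, with \<open>\<real>\<^sup>n\<close> the subspace of sequences supported in
  \<open>{..<n}\<close>.
\<close>

typedef fseq = "{x :: nat \<Rightarrow> real. finite {i. x i \<noteq> 0}}"
  morphisms coord Abs_fseq
  by (intro exI[of _ "\<lambda>_. 0"]) simp

setup_lifting type_definition_fseq

lemma finite_coord_nonzero [simp]: "finite {i. coord x i \<noteq> 0}"
  using coord[of x] by simp

lemma fseq_eqI: "(\<And>i. coord x i = coord y i) \<Longrightarrow> x = y"
  by (metis coord_inject ext)

instantiation fseq :: real_vector
begin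

lift_definition zero_fseq :: fseq is "\<lambda>_. 0" by simp

lift_definition plus_fseq :: "fseq \<Rightarrow> fseq \<Rightarrow> fseq" is "\<lambda>x y i. x i + y i"
proof -
  fix x y :: "nat \<Rightarrow> real"
  assume "finite {i. x i \<noteq> 0}" "finite {i. y i \<noteq> 0}"
  then show "finite {i. x i + y i \<noteq> 0}"
    by (rule_tac finite_subset[of _ "{i. x i \<noteq> 0} \<union> {i. y i \<noteq> 0}"]) auto
qed

lift_definition uminus_fseq :: "fseq \<Rightarrow> fseq" is "\<lambda>x i. - x i" by simp

definition minus_fseq :: "fseq \<Rightarrow> fseq \<Rightarrow> fseq" where "minus_fseq x y = x + - y"

lift_definition scaleR_fseq :: "real \<Rightarrow> fseq \<Rightarrow> fseq" is "\<lambda>r x i. r * x i"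
  by (rule rev_finite_subset) auto

lemma coord_simps [simp]:
  "coord 0 i = 0" "coord (x + y) i = coord x i + coord y i" "coord (- x) i = - coord x i"
  "coord (r *\<^sub>R x) i = r * coord x i"
  by (transfer, simp)+

instance
  by standard (auto intro!: fseq_eqI simp: minus_fseq_def algebra_simps)

end

instantiation fseq :: real_inner
begin

definition inner_fseq :: "fseq \<Rightarrow> fseq \<Rightarrow> real" where
  "inner_fseq x y = (\<Sum>i | coord x i \<noteq> 0. coord x i * coord y i)"

definition norm_fseq :: "fseq \<Rightarrow> real" where "norm_fseq x = sqrt (inner x x)"

definition sgn_fseq :: "fseq \<Rightarrow> fseq" where "sgn_fseq x = x /\<^sub>R norm x"

definition dist_fseq :: "fseq \<Rightarrow> fseq \<Rightarrow> real" where "dist_fseq x y = norm (x - y)"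

definition uniformity_fseq :: "(fseq \<times> fseq) filter" where
  "uniformity_fseq = (INF e\<in>{0<..}. principal {(x, y). dist x y < e})"

definition open_fseq :: "fseq set \<Rightarrow> bool" where
  "open_fseq U \<longleftrightarrow> (\<forall>x\<in>U. \<forall>\<^sub>F (x', y) in uniformity. x' = x \<longrightarrow> y \<in> U)"

lemma inner_fseq_eq_sum:
  assumes "finite A" "{i. coord x i \<noteq> 0} \<inter> {i. coord y i \<noteq> 0} \<subseteq> A"
  shows "inner x y = (\<Sum>i\<in>A. coord x i * coord y i)"
proof -
  have "inner x y = (\<Sum>i\<in>{i. coord x i \<noteq> 0} \<inter> {i. coord y i \<noteq> 0}. coord x i * coord y i)"
    unfolding inner_fseq_def by (rule sum.mono_neutral_right) auto
  also have "\<dots> = (\<Sum>i\<in>A. coord x i * coord y i)"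
    by (rule sum.mono_neutral_left) (use assms in auto)
  finally show ?thesis .
qed

instance
proof
  fix x y z :: fseq and r :: real
  show "inner x y = inner y x"
    using inner_fseq_eq_sum[of "{i. coord x i \<noteq> 0}" x y]
      inner_fseq_eq_sum[of "{i. coord x i \<noteq> 0}" y x] by (simp add: mult.commute Int_commute)
  show "inner (x + y) z = inner x z + inner y z"
    using inner_fseq_eq_sum[of "{i. coord z i \<noteq> 0}" "x + y" z]
      inner_fseq_eq_sum[of "{i. coord z i \<noteq> 0}" x z]
      inner_fseq_eq_sum[of "{i. coord z i \<noteq> 0}" y z]
    by (simp add: sum.distrib algebra_simps)
  show "inner (r *\<^sub>R x) y = r * inner x y"
    using inner_fseq_eq_sum[of "{i. coord y i \<noteq> 0}" "r *\<^sub>R x" y]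
      inner_fseq_eq_sum[of "{i. coord y i \<noteq> 0}" x y]
    by (simp add: sum_distrib_left mult.assoc)
  show "0 \<le> inner x x"
    unfolding inner_fseq_def by (rule sum_nonneg) simp
  show "inner x x = 0 \<longleftrightarrow> x = 0"
    unfolding inner_fseq_def
    by (subst sum_nonneg_eq_0_iff) (auto intro!: fseq_eqI)
qed (simp_all add: norm_fseq_def sgn_fseq_def dist_fseq_def uniformity_fseq_def open_fseq_def)

end

definition Rn :: "nat \<Rightarrow> fseq set" where
  "Rn n = {x. \<forall>i\<ge>n. coord x i = 0}"

lift_definition unit_fseq :: "nat \<Rightarrow> fseq" is "\<lambda>j i. if i = j then 1 else 0"
  by simp

definition orthonormal :: "'a::real_inner set \<Rightarrow> bool" where
  "orthonormal B \<longleftrightarrow> pairwise orthogonal B \<and> (\<forall>b\<in>B. norm b = 1)"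

text \<open>
  For a finite orthonormal set \<open>B\<close> this is the Lebesgue measure of \<open>span B\<close>, as a Borel measure
  concentrated on that subspace; it does not depend on the choice of the orthonormal basis.
  The formula is the one that defines \<^const>\<open>lborel\<close> (with \<^const>\<open>Basis\<close> for \<open>B\<close>).
\<close>

definition lborel_span :: "'a::real_inner set \<Rightarrow> 'a measure" where
  "lborel_span B = distr (\<Pi>\<^sub>M b\<in>B. lborel) borel (\<lambda>f. \<Sum>b\<in>B. f b *\<^sub>R b)"

text \<open>
  The pushed-forward map is measurable (otherwise \<^const>\<open>distr\<close> would degenerate to the null
  measure).
\<close>

lemma measurable_lborel_span:
  fixes B :: "'a::real_inner set"
  assumes "finite B"
  shows "(\<lambda>f. \<Sum>b\<in>B. f b *\<^sub>R b) \<in> measurable (\<Pi>\<^sub>M b\<in>B. lborel) borel"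
proof -
  obtain e where e: "bij_betw e {..<card B} B"
    using ex_bij_betw_nat_finite[OF assms] by (auto simp: atLeast0LessThan)
  let ?g = "\<lambda>(f :: 'a \<Rightarrow> real) i. if i < card B then f (e i) else 0"
  have g: "?g \<in> measurable (\<Pi>\<^sub>M b\<in>B. lborel) borel"
  proof (rule measurable_coordinatewise_then_product)
    fix i :: nat
    have "i < card B \<Longrightarrow> e i \<in> B" using e by (auto simp: bij_betw_def)
    then show "(\<lambda>f. ?g f i) \<in> measurable (\<Pi>\<^sub>M b\<in>B. lborel) borel"
      by (cases "i < card B") (auto intro: measurable_component_singleton)
  qed
  have h: "(\<lambda>x :: nat \<Rightarrow> real. \<Sum>i<card B. x i *\<^sub>R e i) \<in> borel_measurable borel"
    by (intro borel_measurable_continuous_onI continuous_intros continuous_on_product_coordinates)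
  have "(\<lambda>f. \<Sum>b\<in>B. f b *\<^sub>R b) = (\<lambda>x. \<Sum>i<card B. x i *\<^sub>R e i) \<circ> ?g"
    by (auto simp: fun_eq_iff sum.reindex_bij_betw[OF e, symmetric])
  with measurable_comp[OF g h] show ?thesis by simp
qed

text \<open>
  The \<open>d\<close>-dimensional volume of a Borel set lying in some \<open>d\<close>-dimensional linear subspace. If
  it lies in several of them, it is a null set of each, so the value is independent of the
  choice. (No meaning is attached to the value on other sets.)
\<close>

definition vol :: "nat \<Rightarrow> 'a::real_inner set \<Rightarrow> real" where
  "vol d A = measure (lborel_span (SOME B. finite B \<and> card B = d \<and> orthonormal B \<and> A \<subseteq> span B)) A"

definition convex_body :: "nat \<Rightarrow> fseq set \<Rightarrow> bool" where
  "convex_body n K \<longleftrightarrow>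
     K \<subseteq> Rn n \<and> compact K \<and> convex K \<and> (top_of_set (Rn n) interior_of K) \<noteq> {}"

text \<open>
  The vector-valued integral is taken coordinatewise, since \<^typ>\<open>fseq\<close> is not complete.
\<close>

definition centroid :: "nat \<Rightarrow> fseq set \<Rightarrow> fseq" where
  "centroid n K =
     (let M = lborel_span (unit_fseq ` {..<n})
      in (1 / measure M K) *\<^sub>R (\<Sum>i<n. (LINT x:K|M. coord x i) *\<^sub>R unit_fseq i))"

definition pos_ray :: "'a::real_vector \<Rightarrow> 'a set" where
  "pos_ray \<theta> = {t *\<^sub>R \<theta> | t. t \<ge> 0}"

definition neg_ray :: "'a::real_vector \<Rightarrow> 'a set" where
  "neg_ray \<theta> = {t *\<^sub>R \<theta> | t. t \<le> 0}"

end

theory Submission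
  imports Defs
begin

text \<open>
  Let \<open>E\<close> be the span of \<open>F\<close> and \<open>\<theta>\<close>, of dimension \<open>m = n - k + 1\<close>, and let \<open>\<eta>\<close> be \<open>\<theta>\<close> or \<open>- \<theta>\<close>. The
  theorem follows from a sharp inequality of Gruenbaum type: the half of \<open>K \<inter> E\<close> on the side of
  \<open>\<eta>\<close> has at least \<open>(m / (n + 1)) ^ m\<close> times the volume of \<open>K \<inter> E\<close>. Hence the ratio of the two halves
  is at most \<open>((n + 1) / m) ^ m = (1 + k / m) ^ m\<close>, and this is at most \<open>4 * k ^ 2\<close> times
  \<open>(1 + k / m) ^ (m - 2)\<close> because \<open>1 + k / m \<le> 2 * k\<close>.

  For the inequality, let \<open>u x\<close> for \<open>x \<in> K\<close> be the \<open>m\<close>-th root of the volume of the part of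
  \<open>K \<inter> (x + E)\<close> lying beyond \<open>x\<close> in the direction \<open>\<eta>\<close>, and let \<open>\<psi> y\<close> be the \<open>m\<close>-th root of the volume
  of \<open>K \<inter> (y + E)\<close> for \<open>y\<close> orthogonal to \<open>E\<close>. By the Brunn--Minkowski inequality
  (\<open>brunn_minkowski\<close>) both functions are concave where the sections are nonempty. Three estimates
  are combined in \<open>half_section_lower_bound\<close>.

  \<^item> Jensen's inequality at the centroid, \<open>half_radius_zero_ge_mean\<close>: the volume of \<open>K\<close> times \<open>u 0\<close> is at
    least the integral of \<open>u\<close> over \<open>K\<close>.

  \<^item> Within one slice \<open>K \<inter> (y + E)\<close>, the number \<open>u x ^ m\<close> is the volume of an upper tail of the
    coordinate in direction \<open>\<eta>\<close>, so it is uniformly distributed on \<open>[0, \<psi> y ^ m]\<close>. The integral of \<open>u\<close>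
    over the slice is therefore \<open>m / (m + 1) * \<psi> y ^ (m + 1)\<close>; the lower bound is
    \<open>nn_integral_upper_tail\<close>.

  \<^item> Concavity of \<open>\<psi>\<close> on a domain of dimension \<open>k - 1\<close> makes the integral of \<open>\<psi> ^ (m + 1)\<close> at least
    \<open>(m + 1) / (n + 1) * \<psi> 0\<close> times the integral of \<open>\<psi> ^ m\<close>, and the latter is the volume of \<open>K\<close>; this is
    \<open>vrad_power_integral_lower\<close>.

  Together they give \<open>u 0 \<ge> m / (n + 1) * \<psi> 0\<close>, which is the inequality.

  All computations take place in coordinates with respect to an orthonormal basis of \<open>\<real>\<^sup>n\<close> that contains
  bases of \<open>F\<close> and of the orthogonal complement of \<open>E\<close>. The volumes and the centroid of the theorem refer to other bases, and
  \<open>lborel_span_unique\<close> shows that this makes no difference.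
\<close>

section \<open>The Brunn--Minkowski inequality on the line\<close>

lemma nn_integral_layer_cake:
  fixes f :: "'a \<Rightarrow> real"
  assumes "sigma_finite_measure M" and [measurable]: "f \<in> borel_measurable M"
  shows "(\<integral>\<^sup>+x. ennreal (f x) \<partial>M)
    = (\<integral>\<^sup>+s. indicator {0..} s * emeasure M {x \<in> space M. s < f x} \<partial>lborel)"
proof -
  interpret M: sigma_finite_measure M by fact
  interpret P: pair_sigma_finite M "lborel :: real measure" ..
  have "ennreal (f x) = (\<integral>\<^sup>+s. indicator {0..} s * indicator {..<f x} s \<partial>lborel)" for x
  proof -
    have "ennreal (f x) = emeasure lborel {0..<f x}"
      by (cases "0 \<le> f x") (auto simp: ennreal_neg)
    also have "\<dots> = (\<integral>\<^sup>+s. indicator {0..<f x} s \<partial>lborel)" by simp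
    also have "\<dots> = (\<integral>\<^sup>+s. indicator {0..} s * indicator {..<f x} s \<partial>lborel)"
      by (intro nn_integral_cong) (auto simp: indicator_def)
    finally show ?thesis .
  qed
  then have "(\<integral>\<^sup>+x. ennreal (f x) \<partial>M)
      = (\<integral>\<^sup>+x. \<integral>\<^sup>+s. indicator {0..} s * indicator {..<f x} s \<partial>lborel \<partial>M)" by simp
  also have "\<dots> = (\<integral>\<^sup>+s. \<integral>\<^sup>+x. indicator {0..} s * indicator {..<f x} s \<partial>M \<partial>lborel)"
    by (rule P.Fubini'[symmetric]) (simp add: indicator_def lessThan_def)
  also have "\<dots> = (\<integral>\<^sup>+s. indicator {0..} s * emeasure M {x \<in> space M. s < f x} \<partial>lborel)"
  proof (rule nn_integral_cong)
    fix s :: real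
    have "(\<integral>\<^sup>+x. indicator {..<f x} s \<partial>M) = (\<integral>\<^sup>+x. indicator {x \<in> space M. s < f x} x \<partial>M)"
      by (intro nn_integral_cong) (auto simp: indicator_def)
    also have "\<dots> = emeasure M {x \<in> space M. s < f x}" by simp
    finally show "(\<integral>\<^sup>+x. indicator {0..} s * indicator {..<f x} s \<partial>M)
        = indicator {0..} s * emeasure M {x \<in> space M. s < f x}"
      by (subst nn_integral_cmult) (auto simp: indicator_def lessThan_def)
  qed
  finally show ?thesis .
qed

lemma emeasure_lborel_vimage_scale:
  assumes [measurable]: "A \<in> sets borel" and "0 < p"
  shows "emeasure lborel {x::real. x / p + t \<in> A} = ennreal p * emeasure lborel A"
proof -
  have [measurable]: "{x. x / p + t \<in> A} \<in> sets borel"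
    by measurable
  have "emeasure lborel {x. x / p + t \<in> A} = (\<integral>\<^sup>+x. indicator {x. x / p + t \<in> A} x \<partial>lborel)"
    by simp
  also have "\<dots> = ennreal p * (\<integral>\<^sup>+x. indicator {x. x / p + t \<in> A} (- p * t + p * x) \<partial>lborel)"
    using nn_integral_real_affine[of "indicator {x. x / p + t \<in> A}" p "- p * t"] assms by simp
  also have "(\<lambda>x. indicator {x. x / p + t \<in> A} (- p * t + p * x)) = (indicator A :: real \<Rightarrow> ennreal)"
    using assms by (auto simp: indicator_def fun_eq_iff field_simps)
  finally show ?thesis by simp
qed

text \<open>
  One translate of the scaled \<open>A\<close> and one translate of the scaled \<open>B\<close> lie in \<open>C\<close>. Translating by a
  point of \<open>B\<close> near \<open>Inf B\<close> and by a point of \<open>A\<close> near \<open>Sup A\<close> puts the first almost entirely to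
  the left of the second, so the volumes add up to an arbitrarily small error. Near-extremal points
  stand in for the extremal ones, which a measurable set may lack.
\<close>
lemma brunn_minkowski_real:
  fixes A B C :: "real set"
  assumes [measurable]: "A \<in> sets borel" "B \<in> sets borel" "C \<in> sets borel"
    and ne: "A \<noteq> {}" "B \<noteq> {}" and bdd: "A \<subseteq> {-R..R}" "B \<subseteq> {-R..R}" and p: "0 < p" "0 < q"
    and C: "\<And>x y. x \<in> A \<Longrightarrow> y \<in> B \<Longrightarrow> p * x + q * y \<in> C"
  shows "ennreal p * emeasure lborel A + ennreal q * emeasure lborel B \<le> emeasure lborel C"
proof (rule ennreal_le_epsilon)
  fix e :: real assume "0 < e"
  define d where "d = e / (p + q)"
  have d: "0 < d" using \<open>0 < e\<close> p by (simp add: d_def)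
  have bA: "bdd_above A" "bdd_below B" using bdd by (meson bdd_above_mono bdd_above_Icc bdd_below_mono bdd_below_Icc)+
  obtain a where a: "a \<in> A" "Sup A - d < a"
    using less_cSupD[of A "Sup A - d"] ne d by auto
  obtain b where b: "b \<in> B" "b < Inf B + d"
    using cInf_lessD[of B "Inf B + d"] ne d by auto
  have AS: "x \<le> Sup A" if "x \<in> A" for x using that bA by (simp add: cSup_upper)
  have BI: "Inf B \<le> x" if "x \<in> B" for x using that bA by (simp add: cInf_lower)
  \<comment> \<open>the two translates overlap only in an interval of length at most \<open>e\<close>\<close>
  define c where "c = p * a + q * Inf B"
  define A' where "A' = {x. x / p + - (q * b / p) \<in> A}"
  define B' where "B' = {x. x / q + - (p * a / q) \<in> B}"
  have [measurable]: "A' \<in> sets borel" "B' \<in> sets borel" unfolding A'_def B'_def by measurable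
  have eA: "emeasure lborel A' = p * emeasure lborel A"
    unfolding A'_def using p by (intro emeasure_lborel_vimage_scale) auto
  have eB: "emeasure lborel B' = q * emeasure lborel B"
    unfolding B'_def using p by (intro emeasure_lborel_vimage_scale) auto
  have A'C: "A' \<subseteq> C"
  proof
    fix x assume "x \<in> A'" then have "p * (x / p + - (q * b / p)) + q * b \<in> C" unfolding A'_def using C b by blast
    moreover have "p * (x / p + - (q * b / p)) + q * b = x" using p by (simp add: field_simps)
    ultimately show "x \<in> C" by simp
  qed
  have B'C: "B' \<subseteq> C \<inter> {c..}"
  proof
    fix x assume x: "x \<in> B'" then have "p * a + q * (x / q + - (p * a / q)) \<in> C" unfolding B'_def using C a by blast
    moreover have "p * a + q * (x / q + - (p * a / q)) = x" using p by (simp add: field_simps)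
    moreover have "Inf B \<le> x / q + - (p * a / q)" using x BI by (simp add: B'_def)
    then have "c \<le> x" using p by (simp add: c_def field_simps)
    ultimately show "x \<in> C \<inter> {c..}" by simp
  qed
  have A'sub: "A' \<subseteq> (A' \<inter> {..<c}) \<union> {c..c + e}"
  proof
    fix x assume x: "x \<in> A'"
    then have "x / p + - (q * b / p) \<le> Sup A" using AS by (simp add: A'_def)
    then have "x \<le> p * Sup A + q * b" using p by (simp add: field_simps)
    also have "\<dots> \<le> p * (a + d) + q * (Inf B + d)" using a b p by (intro add_mono mult_left_mono) auto
    also have "\<dots> = c + (p + q) * d" by (simp add: c_def algebra_simps)
    also have "\<dots> = c + e" using p by (simp add: d_def)
    finally show "x \<in> (A' \<inter> {..<c}) \<union> {c..c + e}" using x by auto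
  qed
  have "emeasure lborel A' \<le> emeasure lborel (A' \<inter> {..<c}) + emeasure lborel {c..c + e}"
    by (rule order_trans[OF emeasure_mono[OF A'sub] emeasure_subadditive]) auto
  also have "emeasure lborel {c..c + e} = e" using \<open>0 < e\<close> by simp
  finally have "emeasure lborel A' + emeasure lborel B'
      \<le> (emeasure lborel (A' \<inter> {..<c}) + emeasure lborel B') + e"
    by (metis add.assoc add.commute add_right_mono)
  also have "emeasure lborel (A' \<inter> {..<c}) + emeasure lborel B' = emeasure lborel ((A' \<inter> {..<c}) \<union> B')"
    using B'C by (intro plus_emeasure) auto
  also have "\<dots> \<le> emeasure lborel C" using A'C B'C by (intro emeasure_mono) auto
  finally show "p * emeasure lborel A + q * emeasure lborel B \<le> emeasure lborel C + ennreal e"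
    unfolding eA eB by simp
qed

text \<open>
  The superlevel sets of \<open>f\<close> and \<open>g\<close> are combined level by level. The common supremum \<open>1\<close> is what
  makes both superlevel sets nonempty for every level below \<open>1\<close>; without it the one-dimensional
  inequality could not be applied at the levels that only one of the functions reaches.
\<close>
lemma integral_ge_of_min_ge:
  fixes f g h :: "real \<Rightarrow> real"
  assumes [measurable]: "f \<in> borel_measurable borel" "g \<in> borel_measurable borel" "h \<in> borel_measurable borel"
    and f: "\<And>x. f x \<le> 1" "\<And>s. s < 1 \<Longrightarrow> \<exists>x. s < f x" "\<And>x. 0 < f x \<Longrightarrow> \<bar>x\<bar> \<le> R"
    and g: "\<And>x. g x \<le> 1" "\<And>s. s < 1 \<Longrightarrow> \<exists>x. s < g x" "\<And>x. 0 < g x \<Longrightarrow> \<bar>x\<bar> \<le> R"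
    and p: "0 < p" "0 < q"
    and h: "\<And>x y. 0 < f x \<Longrightarrow> 0 < g y \<Longrightarrow> min (f x) (g y) \<le> h (p * x + q * y)"
  shows "ennreal p * (\<integral>\<^sup>+x. f x \<partial>lborel) + ennreal q * (\<integral>\<^sup>+x. g x \<partial>lborel) \<le> (\<integral>\<^sup>+x. h x \<partial>lborel)"
proof -
  have lc: "(\<integral>\<^sup>+x. ennreal (k x) \<partial>lborel)
      = (\<integral>\<^sup>+s. indicator {0..} s * emeasure lborel {x. s < k x} \<partial>lborel)"
    if "k \<in> borel_measurable borel" for k :: "real \<Rightarrow> real"
    using nn_integral_layer_cake[OF sigma_finite_lborel, of k] that by simp
  have [measurable]: "(\<lambda>s. emeasure lborel {x. s < k x}) \<in> borel_measurable borel"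
    if [measurable]: "k \<in> borel_measurable borel" for k :: "real \<Rightarrow> real"
  proof -
    have "(\<lambda>s. emeasure lborel {x \<in> space lborel. s < k x}) \<in> borel_measurable borel" by measurable
    then show ?thesis by simp
  qed
  have "ennreal p * (\<integral>\<^sup>+x. f x \<partial>lborel) + ennreal q * (\<integral>\<^sup>+x. g x \<partial>lborel)
     = (\<integral>\<^sup>+s. p * (indicator {0..} s * emeasure lborel {x. s < f x}) +
              q * (indicator {0..} s * emeasure lborel {x. s < g x}) \<partial>lborel)"
    unfolding lc[OF assms(1)] lc[OF assms(2)]
    by (subst nn_integral_add) (auto simp: nn_integral_cmult)
  also have "\<dots> \<le> (\<integral>\<^sup>+s. indicator {0..} s * emeasure lborel {x. s < h x} \<partial>lborel)"
  proof (rule nn_integral_mono)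
    fix s :: real
    consider "s < 0" | "1 \<le> s" | "0 \<le> s" "s < 1" by linarith
    then show "p * (indicator {0..} s * emeasure lborel {x. s < f x}) +
              q * (indicator {0..} s * emeasure lborel {x. s < g x}) \<le> indicator {0..} s * emeasure lborel {x. s < h x}"
    proof cases
      case 2
      then have "{x. s < f x} = {}" "{x. s < g x} = {}" using f(1) g(1) by (auto simp: not_less intro: order_trans)
      then show ?thesis by simp
    next
      case 3
      have "ennreal p * emeasure lborel {x. s < f x} + ennreal q * emeasure lborel {x. s < g x} \<le> emeasure lborel {x. s < h x}"
      proof (rule brunn_minkowski_real[where R = R])
        show "{x. s < f x} \<noteq> {}" "{x. s < g x} \<noteq> {}" using f(2) g(2) 3 by auto
        show "{x. s < f x} \<subseteq> {-R..R}" by (auto dest!: order.strict_trans1[OF 3(1)] f(3))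
        show "{x. s < g x} \<subseteq> {-R..R}" by (auto dest!: order.strict_trans1[OF 3(1)] g(3))
        show "p * x + q * y \<in> {x. s < h x}" if "x \<in> {x. s < f x}" "y \<in> {x. s < g x}" for x y
          using h[of x y] that 3 by auto
      qed (use p in auto)
      then show ?thesis using 3 by simp
    qed simp
  qed
  finally show ?thesis unfolding lc[OF assms(3)] .
qed

section \<open>Lebesgue measure on finite products of lines\<close>

abbreviation leb :: "'i set \<Rightarrow> ('i \<Rightarrow> real) measure" where
  "leb I \<equiv> PiM I (\<lambda>_. lborel)"

lemma product_sigma_finite_lborel: "product_sigma_finite (\<lambda>_. lborel :: real measure)"
  by (simp add: product_sigma_finite_def sigma_finite_lborel)

lemma sigma_finite_leb: "finite I \<Longrightarrow> sigma_finite_measure (leb I)"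
  by (rule product_sigma_finite.sigma_finite[OF product_sigma_finite_lborel])

lemma emeasure_leb_box:
  assumes "finite I" "0 \<le> r"
  shows "emeasure (leb I) (\<Pi>\<^sub>E i\<in>I. {-r..r}) = ennreal ((2 * r) ^ card I)"
  using assms by (subst product_sigma_finite.emeasure_PiM[OF product_sigma_finite_lborel])
    (auto simp: ennreal_power)

lemma sets_Collect_preimage:
  "T \<in> measurable M N \<Longrightarrow> A \<in> sets N \<Longrightarrow> {x \<in> space M. T x \<in> A} \<in> sets M"
  using measurable_sets[of T M N A] by (simp add: vimage_def Int_def conj_commute)

lemma measurable_leb_affine:
  assumes e: "bij_betw e J I"
  shows "(\<lambda>w. \<lambda>j\<in>J. a j + c * w (e j)) \<in> measurable (leb I) (leb J)"
proof (rule measurable_restrict)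
  fix j assume "j \<in> J"
  then have "(\<lambda>w. w (e j)) \<in> measurable (leb I) lborel" using e
    by (intro measurable_component_singleton) (auto simp: bij_betw_def)
  then have [measurable]: "(\<lambda>w. w (e j)) \<in> borel_measurable (leb I)" by simp
  show "(\<lambda>w. a j + c * w (e j)) \<in> measurable (leb I) lborel" by simp
qed

text \<open>
  Translations, dilations, the reflection and relabelling of coordinates in one statement, proved
  by comparing the values on boxes.
\<close>
lemma leb_affine:
  fixes a :: "'j \<Rightarrow> real" and e :: "'j \<Rightarrow> 'i"
  assumes "finite I" and e: "bij_betw e J I" and "c \<noteq> 0"
  shows "leb J = scale_measure (ennreal \<bar>c\<bar> ^ card I) (distr (leb I) (leb J) (\<lambda>w. \<lambda>j\<in>J. a j + c * w (e j)))"
proof -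
  interpret L: product_sigma_finite "\<lambda>_. lborel :: real measure" by (rule product_sigma_finite_lborel)
  let ?T = "\<lambda>w. \<lambda>j\<in>J. a j + c * w (e j)"
  have "finite J" using assms bij_betw_finite by blast
  have eI: "e j \<in> I" if "j \<in> J" for j using e that by (auto simp: bij_betw_def)
  define e' where "e' = inv_into J e"
  have e': "e' (e j) = j" if "j \<in> J" for j using e that by (simp add: e'_def bij_betw_inv_into_left)
  have e'I: "e' i \<in> J" "e (e' i) = i" if "i \<in> I" for i
    using e that by (simp_all add: e'_def bij_betw_inv_into_right) (metis bij_betw_def inv_into_into)
  have T[measurable]: "?T \<in> measurable (leb I) (leb J)" by (rule measurable_leb_affine[OF e])
  have "scale_measure (ennreal \<bar>c\<bar> ^ card I) (distr (leb I) (leb J) ?T) = leb J"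
  proof (rule L.PiM_eqI[OF \<open>finite J\<close>])
    fix A :: "'j \<Rightarrow> real set" assume A: "\<And>i. i \<in> J \<Longrightarrow> A i \<in> sets lborel"
    let ?A = "\<lambda>i. {t. a (e' i) + c * t \<in> A (e' i)}"
    have mA: "{t. a j + c * t \<in> A j} \<in> sets borel" if "j \<in> J" for j
    proof -
      have [measurable]: "A j \<in> sets borel" using A[OF that] by simp
      show ?thesis by measurable
    qed
    have "?T -` Pi\<^sub>E J A \<inter> space (leb I) = Pi\<^sub>E I ?A"
    proof (intro set_eqI iffI)
      fix w assume w: "w \<in> ?T -` Pi\<^sub>E J A \<inter> space (leb I)"
      have "w i \<in> ?A i" if "i \<in> I" for i
      proof -
        have "?T w (e' i) \<in> A (e' i)" using w e'I(1)[OF that] by (blast dest: PiE_mem)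
        then show ?thesis using e'I[OF that] by simp
      qed
      then show "w \<in> Pi\<^sub>E I ?A" using w by (simp add: space_PiM PiE_iff)
    next
      fix w assume w: "w \<in> Pi\<^sub>E I ?A"
      have "a j + c * w (e j) \<in> A j" if "j \<in> J" for j
        using PiE_mem[OF w eI[OF that]] e'[OF that] by simp
      then show "w \<in> ?T -` Pi\<^sub>E J A \<inter> space (leb I)" using w by (simp add: space_PiM PiE_iff)
    qed
    then have "emeasure (distr (leb I) (leb J) ?T) (Pi\<^sub>E J A) = emeasure (leb I) (Pi\<^sub>E I ?A)"
      using A \<open>finite J\<close> by (subst emeasure_distr) (auto intro!: sets_PiM_I_finite)
    also have "\<dots> = (\<Prod>i\<in>I. emeasure lborel (?A i))"
      using assms(1) mA e'I by (subst L.emeasure_PiM) auto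
    also have "\<dots> = (\<Prod>j\<in>J. emeasure lborel (?A (e j)))"
      by (rule prod.reindex_bij_betw[OF e, symmetric])
    also have "\<dots> = (\<Prod>j\<in>J. emeasure lborel {t. a j + c * t \<in> A j})" using e' by (intro prod.cong) auto
    finally have "emeasure (scale_measure (ennreal \<bar>c\<bar> ^ card I) (distr (leb I) (leb J) ?T)) (Pi\<^sub>E J A)
        = ennreal \<bar>c\<bar> ^ card J * (\<Prod>j\<in>J. emeasure lborel {t. a j + c * t \<in> A j})"
      using bij_betw_same_card[OF e] by simp
    also have "\<dots> = (\<Prod>j\<in>J. ennreal \<bar>c\<bar> * emeasure lborel {t. a j + c * t \<in> A j})"
      by (simp add: prod.distrib)
    also have "\<dots> = (\<Prod>j\<in>J. emeasure lborel (A j))"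
    proof (rule prod.cong[OF refl])
      fix j assume j: "j \<in> J"
      have [measurable]: "A j \<in> sets borel" "{t. a j + c * t \<in> A j} \<in> sets borel" using A mA j by auto
      have "(\<lambda>t. indicator (A j) (a j + c * t)) = (indicator {t. a j + c * t \<in> A j} :: real \<Rightarrow> ennreal)"
        by (auto simp: indicator_def)
      then show "ennreal \<bar>c\<bar> * emeasure lborel {t. a j + c * t \<in> A j} = emeasure lborel (A j)"
        using nn_integral_real_affine[of "indicator (A j)" c "a j"] \<open>c \<noteq> 0\<close> by simp
    qed
    finally show "emeasure (scale_measure (ennreal \<bar>c\<bar> ^ card I) (distr (leb I) (leb J) ?T)) (Pi\<^sub>E J A)
      = (\<Prod>j\<in>J. emeasure lborel (A j))" .
  qed simp
  then show ?thesis by simp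
qed

lemma nn_integral_leb_affine:
  assumes "finite I" "bij_betw e J I" "c \<noteq> 0" and f: "f \<in> borel_measurable (leb J)"
  shows "(\<integral>\<^sup>+w. f w \<partial>leb J)
    = ennreal \<bar>c\<bar> ^ card I * (\<integral>\<^sup>+w. f (\<lambda>j\<in>J. a j + c * w (e j)) \<partial>leb I)"
proof -
  let ?T = "\<lambda>w. \<lambda>j\<in>J. a j + c * w (e j)"
  have "(\<integral>\<^sup>+w. f w \<partial>leb J) = (\<integral>\<^sup>+w. f w \<partial>scale_measure (ennreal \<bar>c\<bar> ^ card I) (distr (leb I) (leb J) ?T))"
    using leb_affine[OF assms(1-3), of a] by simp
  also have "\<dots> = ennreal \<bar>c\<bar> ^ card I * (\<integral>\<^sup>+w. f (?T w) \<partial>leb I)"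
    using f by (subst nn_integral_scale_measure) (simp_all add: nn_integral_distr measurable_leb_affine[OF assms(2)])
  finally show ?thesis .
qed

lemma emeasure_leb_affine:
  assumes "finite I" "bij_betw e J I" "c \<noteq> 0" and A: "A \<in> sets (leb J)"
  shows "emeasure (leb J) A
    = ennreal \<bar>c\<bar> ^ card I * emeasure (leb I) {w \<in> space (leb I). (\<lambda>j\<in>J. a j + c * w (e j)) \<in> A}"
proof -
  let ?T = "\<lambda>w. \<lambda>j\<in>J. a j + c * w (e j)"
  have "emeasure (leb J) A = ennreal \<bar>c\<bar> ^ card I * (\<integral>\<^sup>+w. indicator A (?T w) \<partial>leb I)"
    using nn_integral_leb_affine[OF assms(1-3), of "indicator A" a] A by simp
  also have "(\<integral>\<^sup>+w. indicator A (?T w) \<partial>leb I) = (\<integral>\<^sup>+w. indicator {w \<in> space (leb I). ?T w \<in> A} w \<partial>leb I)"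
    by (intro nn_integral_cong) (auto simp: indicator_def)
  also have "\<dots> = emeasure (leb I) {w \<in> space (leb I). ?T w \<in> A}"
    by (intro nn_integral_indicator sets_Collect_preimage[OF measurable_leb_affine[OF assms(2)] A])
  finally show ?thesis .
qed

section \<open>The Brunn--Minkowski inequality in a finite product\<close>

text \<open>
  This is Hoelder's inequality for two terms, obtained as convexity of the power function at the
  points \<open>s / a\<close> and \<open>t / b\<close> with weights proportional to \<open>p * a\<close> and \<open>q * b\<close>. It is the numerical
  step of the induction on the dimension.
\<close>
lemma power_mean_two:
  fixes p q a b s t :: real
  assumes "0 < p" "0 < q" "0 < a" "0 < b" "0 \<le> s" "0 \<le> t"
  shows "(p * s + q * t) ^ Suc m \<le> (p * a + q * b) ^ m * (p * (s ^ Suc m / a ^ m) + q * (t ^ Suc m / b ^ m))"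
proof -
  define N where "N = p * a + q * b"
  have N: "0 < N" using assms by (simp add: N_def add_pos_pos)
  define u where "u = q * b / N"
  have u: "0 \<le> u" "u \<le> 1" "1 - u = p * a / N" using N assms
    by (auto simp: u_def N_def field_simps)
  have cv: "convex_on {0..} (\<lambda>x::real. x ^ Suc m)"
    using convex_power_odd[of "Suc m"] convex_on_subset[OF convex_power_even[of "Suc m"], of "{0..}"]
    by (cases "even (Suc m)") auto
  have "((1 - u) *\<^sub>R (s / a) + u *\<^sub>R (t / b)) ^ Suc m \<le> (1 - u) * (s / a) ^ Suc m + u * (t / b) ^ Suc m"
    using convex_onD[OF cv u(1,2), of "s / a" "t / b"] assms by simp
  also have "(1 - u) *\<^sub>R (s / a) + u *\<^sub>R (t / b) = (p * s + q * t) / N"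
    using assms N unfolding u(3) by (simp add: u_def add_divide_distrib)
  finally have "N ^ Suc m * ((p * s + q * t) / N) ^ Suc m \<le> N ^ Suc m * ((1 - u) * (s / a) ^ Suc m + u * (t / b) ^ Suc m)"
    using N by (intro mult_left_mono) auto
  also have "N ^ Suc m * ((p * s + q * t) / N) ^ Suc m = (p * s + q * t) ^ Suc m"
    using N by (simp add: power_divide del: power_Suc)
  also have "N ^ Suc m * ((1 - u) * (s / a) ^ Suc m + u * (t / b) ^ Suc m)
    = N ^ m * (p * (s ^ Suc m / a ^ m) + q * (t ^ Suc m / b ^ m))"
  proof -
    have abstract: "N * Nm * (p * a / N * (X / (a * A)) + q * b / N * (Y / (b * B))) = Nm * (p * (X / A) + q * (Y / B))"
      if "0 < A" "0 < B" for Nm X Y A B :: real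
      using that N assms by (simp add: field_simps)
    show ?thesis unfolding u(3) unfolding u_def power_divide power_Suc[of N] power_Suc[of a] power_Suc[of b]
      using assms by (intro abstract) auto
  qed
  finally show ?thesis by (simp add: N_def)
qed


lemma ex_power_eq:
  fixes v :: real
  assumes "0 < v" "m = 0 \<Longrightarrow> v = 1"
  obtains r where "0 < r" "r ^ m = v"
proof (cases "m = 0")
  case True
  with assms that[of 1] show ?thesis by simp
next
  case False
  with assms that[of "root m v"] show ?thesis by simp
qed

lemma measurable_slice:
  assumes "A \<in> sets (leb (insert i I))" "i \<notin> I"
  shows "{x \<in> space (leb I). x(i := t) \<in> A} \<in> sets (leb I)"
proof -
  have "(\<lambda>x. x(i := t)) \<in> measurable (leb I) (leb (insert i I))"
    using measurable_compose[OF _ measurable_add_dim[of i I "\<lambda>_. lborel"], of "\<lambda>x. (x, t)" "leb I"] by simp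
  then show ?thesis by (rule sets_Collect_preimage) (rule assms)
qed

lemma slice_subset_box:
  assumes "A \<subseteq> (\<Pi>\<^sub>E j\<in>insert i I. X)" "i \<notin> I"
  shows "{x \<in> space (leb I). x(i := t) \<in> A} \<subseteq> (\<Pi>\<^sub>E j\<in>I. X)"
proof
  fix x assume x: "x \<in> {x \<in> space (leb I). x(i := t) \<in> A}"
  then have "x(i := t) \<in> (\<Pi>\<^sub>E j\<in>insert i I. X)" using assms by blast
  from PiE_mem[OF this] have "x j \<in> X" if "j \<in> I" for j using that assms(2) by (metis fun_upd_other insertCI)
  then show "x \<in> (\<Pi>\<^sub>E j\<in>I. X)" using x by (auto simp: space_PiM PiE_iff)
qed

lemma measurable_emeasure_slice:
  assumes "finite I" "A \<in> sets (leb (insert i I))" "i \<notin> I"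
  shows "(\<lambda>t. emeasure (leb I) {x \<in> space (leb I). x(i := t) \<in> A}) \<in> borel_measurable borel"
proof -
  interpret sigma_finite_measure "leb I" by (rule sigma_finite_leb) fact
  have m: "(\<lambda>p. (snd p)(i := fst p)) \<in> measurable (lborel \<Otimes>\<^sub>M leb I) (leb (insert i I))"
    using measurable_compose[OF _ measurable_add_dim[of i I "\<lambda>_. lborel"], of "\<lambda>p. (snd p, fst p)" "lborel \<Otimes>\<^sub>M leb I"]
    by simp
  have "{p \<in> space (lborel \<Otimes>\<^sub>M leb I). (snd p)(i := fst p) \<in> A} \<in> sets (lborel \<Otimes>\<^sub>M leb I)"
    by (rule sets_Collect_preimage[OF m assms(2)])
  from measurable_emeasure_Pair[OF this]
  show ?thesis by (simp add: space_pair_measure vimage_def)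
qed

lemma emeasure_leb_insert:
  assumes "finite I" "A \<in> sets (leb (insert i I))" "i \<notin> I"
  shows "emeasure (leb (insert i I)) A = (\<integral>\<^sup>+t. emeasure (leb I) {x \<in> space (leb I). x(i := t) \<in> A} \<partial>lborel)"
proof -
  interpret L: product_sigma_finite "\<lambda>_. lborel :: real measure" by (rule product_sigma_finite_lborel)
  have "emeasure (leb (insert i I)) A = (\<integral>\<^sup>+t. (\<integral>\<^sup>+x. indicator A (x(i := t)) \<partial>leb I) \<partial>lborel)"
    using L.product_nn_integral_insert_rev[OF assms(1,3), of "indicator A"] assms(2) by simp
  also have "(\<lambda>t. \<integral>\<^sup>+x. indicator A (x(i := t)) \<partial>leb I)
      = (\<lambda>t. \<integral>\<^sup>+x. indicator {x \<in> space (leb I). x(i := t) \<in> A} x \<partial>leb I)"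
    by (intro ext nn_integral_cong) (auto simp: indicator_def)
  finally show ?thesis using measurable_slice[OF assms(2,3)] by simp
qed

text \<open>
  The volume of the section of \<open>A\<close> at height \<open>t\<close> is written as \<open>a ^ m * F t\<close>, with \<open>F\<close> of supremum
  \<open>1\<close>: so \<open>a\<close> is the \<open>m\<close>-th root of the largest section volume. If \<open>m = 0\<close> the sections have volume
  \<open>0\<close> or \<open>1\<close> and \<open>F\<close> is an indicator function; recording this lets the induction start at
  dimension \<open>0\<close>.
\<close>
lemma normalised_slice_volumes:
  assumes "finite I" "A \<in> sets (leb (insert i I))" "i \<notin> I" and box: "A \<subseteq> (\<Pi>\<^sub>E j\<in>insert i I. {-R..R})"
    and "0 < emeasure (leb (insert i I)) A"
  obtains a F where "0 < a" "F \<in> borel_measurable borel" "\<forall>t. (0::real) \<le> F t" "\<forall>t. F t \<le> 1" "\<forall>s<1. \<exists>t. s < F t"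
    "\<forall>t. 0 < F t \<longrightarrow> \<bar>t\<bar> \<le> R" "\<forall>t. card I = 0 \<longrightarrow> 0 < F t \<longrightarrow> F t = 1"
    "\<forall>t. emeasure (leb I) {x \<in> space (leb I). x(i := t) \<in> A} = ennreal (a ^ card I * F t)"
    "emeasure (leb (insert i I)) A = ennreal (a ^ card I) * (\<integral>\<^sup>+t. F t \<partial>lborel)"
proof -
  define S where "S t = {x \<in> space (leb I). x(i := t) \<in> A}" for t
  define f where "f t = measure (leb I) (S t)" for t
  have R: "0 \<le> R"
  proof -
    have "A \<noteq> {}" using assms(5) by auto
    then obtain x where "x \<in> A" by auto
    then have "x i \<in> {-R..R}" using box by (intro PiE_mem[of x "insert i I"]) auto
    then show ?thesis by simp
  qed
  have Sbox: "S t \<subseteq> (\<Pi>\<^sub>E j\<in>I. {-R..R})" for t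
    unfolding S_def by (rule slice_subset_box[OF box assms(3)])
  have Sm: "S t \<in> sets (leb I)" for t unfolding S_def by (rule measurable_slice[OF assms(2,3)])
  have Sle: "emeasure (leb I) (S t) \<le> ennreal ((2 * R) ^ card I)" for t
    using emeasure_mono[OF Sbox, of "leb I" t] assms(1) R by (simp add: emeasure_leb_box sets_PiM_I_finite)
  have Sfin: "emeasure (leb I) (S t) = ennreal (f t)" for t
    unfolding f_def by (rule emeasure_eq_ennreal_measure) (use Sle[of t] in \<open>auto simp: top_unique\<close>)
  have f0: "0 \<le> f t" for t by (simp add: f_def)
  have fle: "f t \<le> (2 * R) ^ card I" for t using Sle[of t] R unfolding Sfin by simp
  have fbdd: "bdd_above (range f)" using fle by (auto simp: bdd_above_def)
  have fm: "f \<in> borel_measurable borel"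
    using measurable_emeasure_slice[OF assms(1-3)] unfolding f_def measure_def S_def by measurable
  have eA: "emeasure (leb (insert i I)) A = (\<integral>\<^sup>+t. f t \<partial>lborel)"
    using emeasure_leb_insert[OF assms(1-3)] Sfin by (simp add: S_def)
  define \<alpha> where "\<alpha> = (SUP t. f t)"
  have fa: "f t \<le> \<alpha>" for t unfolding \<alpha>_def using fbdd by (rule cSUP_upper[rotated]) simp
  have "\<exists>t. 0 < f t"
  proof (rule ccontr)
    assume "\<nexists>t. 0 < f t"
    then have "f t = 0" for t using f0[of t] by (simp add: not_less order_antisym)
    with eA assms(5) show False by simp
  qed
  then obtain t0 where t0: "0 < f t0" ..
  then have a0: "0 < \<alpha>" using fa[of t0] by simp
  have f01: "f t = 1" if "card I = 0" "0 < f t" for t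
  proof -
    have I: "I = {}" using that assms(1) by simp
    have "S t \<noteq> {}" using that(2) by (auto simp: f_def)
    then have "S t = {\<lambda>_. undefined}" by (auto simp: S_def space_PiM I)
    moreover have "emeasure (leb I) {\<lambda>_. undefined} = 1" unfolding I
      using product_sigma_finite.emeasure_PiM[OF product_sigma_finite_lborel, of "{}" "\<lambda>_. {}"] by simp
    ultimately show ?thesis by (simp add: f_def measure_def)
  qed
  have a1: "\<alpha> = 1" if "card I = 0"
  proof (rule antisym)
    show "\<alpha> \<le> 1" unfolding \<alpha>_def using fle that by (intro cSUP_least) auto
    show "1 \<le> \<alpha>" using f01[OF that t0] fa[of t0] by simp
  qed
  obtain a where a: "0 < a" "a ^ card I = \<alpha>" by (rule ex_power_eq[OF a0 a1])
  show ?thesis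
  proof (rule that[of a "\<lambda>t. f t / \<alpha>"])
    show "\<forall>t. f t / \<alpha> \<le> 1" using fa a0 by simp
    show "\<forall>s<1. \<exists>t. s < f t / \<alpha>"
    proof (intro allI impI)
      fix s :: real assume that: "s < 1"
      have "s * \<alpha> < \<alpha>" using that a0 by simp
      then obtain t where "s * \<alpha> < f t" unfolding \<alpha>_def using less_cSUP_iff[OF _ fbdd] by auto
      then show "\<exists>t. s < f t / \<alpha>" using a0 by (auto simp: field_simps)
    qed
    have "\<bar>t\<bar> \<le> R" if "0 < f t / \<alpha>" for t
    proof -
      have "S t \<noteq> {}" using that by (auto simp: f_def)
      then obtain x where "x(i := t) \<in> (\<Pi>\<^sub>E j\<in>insert i I. {-R..R})" using box unfolding S_def by blast
      then have "(x(i := t)) i \<in> {-R..R}" by (rule PiE_mem) simp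
      then show ?thesis by auto
    qed
    then show "\<forall>t. 0 < f t / \<alpha> \<longrightarrow> \<bar>t\<bar> \<le> R" by blast
    have "f t / \<alpha> = 1" if "card I = 0" "0 < f t / \<alpha>" for t
      using f01[OF that(1), of t] a1[OF that(1)] that(2) by simp
    then show "\<forall>t. card I = 0 \<longrightarrow> 0 < f t / \<alpha> \<longrightarrow> f t / \<alpha> = 1" by blast
    show "\<forall>t. emeasure (leb I) {x \<in> space (leb I). x(i := t) \<in> A} = ennreal (a ^ card I * (f t / \<alpha>))"
      using Sfin a0 a by (simp add: S_def)
    have "(\<integral>\<^sup>+t. f t \<partial>lborel) = (\<integral>\<^sup>+t. ennreal \<alpha> * ennreal (f t / \<alpha>) \<partial>lborel)"
      using a0 f0 by (intro nn_integral_cong) (simp add: ennreal_mult'[symmetric])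
    then show "emeasure (leb (insert i I)) A = ennreal (a ^ card I) * (\<integral>\<^sup>+t. ennreal (f t / \<alpha>) \<partial>lborel)"
      using fm by (simp add: eA a nn_integral_cmult)
  qed (use a fm a0 f0 in auto)
qed

text \<open>
  Induction on the dimension. Let \<open>a\<close> and \<open>b\<close> be the \<open>m\<close>-th roots of the largest section volumes of
  \<open>A\<close> and \<open>B\<close>. By the induction hypothesis the section volumes of \<open>C\<close>, divided by
  \<open>(p * a + q * b) ^ m\<close>, dominate the minimum of the normalised section volumes of \<open>A\<close> and \<open>B\<close>, so
  the one-dimensional inequality bounds \<open>C\<close> from below by the two integrals, and
  \<open>power_mean_two\<close> turns the result into the required power. Normalising by
  the suprema in this way replaces the usual reduction to sets of volume \<open>1\<close>, and phrasing the claim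
  with powers of \<open>s\<close> and \<open>t\<close> keeps roots out of the induction.
\<close>
lemma brunn_minkowski_pos:
  assumes "finite I" "A \<in> sets (leb I)" "B \<in> sets (leb I)" "C \<in> sets (leb I)"
    and "A \<subseteq> (\<Pi>\<^sub>E i\<in>I. {-R..R})" "B \<subseteq> (\<Pi>\<^sub>E i\<in>I. {-R..R})" "C \<subseteq> (\<Pi>\<^sub>E i\<in>I. {-R..R})"
    and p: "0 < p" "0 < q"
    and "\<And>x y. x \<in> A \<Longrightarrow> y \<in> B \<Longrightarrow> (\<lambda>i\<in>I. p * x i + q * y i) \<in> C"
    and "0 \<le> s" "0 \<le> t" "ennreal (s ^ card I) \<le> emeasure (leb I) A" "ennreal (t ^ card I) \<le> emeasure (leb I) B"
    and "0 < emeasure (leb I) A" "0 < emeasure (leb I) B"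
  shows "ennreal ((p * s + q * t) ^ card I) \<le> emeasure (leb I) C"
  using assms(1-7,10-)
proof (induction I arbitrary: A B C s t rule: finite_induct)
  case empty
  have "A \<noteq> {}" "B \<noteq> {}" using empty by auto
  then have "C = {\<lambda>_. undefined}" using empty by (auto simp: PiE_iff extensional_def restrict_def)
  then show ?case
    using product_sigma_finite.emeasure_PiM[OF product_sigma_finite_lborel, of "{}" "\<lambda>_. {}"] by simp
next
  case (insert i I)
  let ?m = "card I"
  let ?s = "\<lambda>A t. {x \<in> space (leb I). x(i := t) \<in> A}"
  note ff = insert.hyps
  obtain a F where a: "0 < a" and F': "F \<in> borel_measurable borel" "\<forall>t. (0::real) \<le> F t" "\<forall>t. F t \<le> 1" "\<forall>s<1. \<exists>t. s < F t"
    "\<forall>t. 0 < F t \<longrightarrow> \<bar>t\<bar> \<le> R" "\<forall>t. ?m = 0 \<longrightarrow> 0 < F t \<longrightarrow> F t = 1"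
    "\<forall>t. emeasure (leb I) (?s A t) = ennreal (a ^ ?m * F t)"
    "emeasure (leb (insert i I)) A = ennreal (a ^ ?m) * (\<integral>\<^sup>+t. F t \<partial>lborel)"
    by (rule normalised_slice_volumes[OF ff(1) insert.prems(1) ff(2) insert.prems(4,12)]) (rule that)
  note F = F'[rule_format]
  obtain b G where b: "0 < b" and G': "G \<in> borel_measurable borel" "\<forall>t. (0::real) \<le> G t" "\<forall>t. G t \<le> 1" "\<forall>s<1. \<exists>t. s < G t"
    "\<forall>t. 0 < G t \<longrightarrow> \<bar>t\<bar> \<le> R" "\<forall>t. ?m = 0 \<longrightarrow> 0 < G t \<longrightarrow> G t = 1"
    "\<forall>t. emeasure (leb I) (?s B t) = ennreal (b ^ ?m * G t)"
    "emeasure (leb (insert i I)) B = ennreal (b ^ ?m) * (\<integral>\<^sup>+t. G t \<partial>lborel)"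
    by (rule normalised_slice_volumes[OF ff(1) insert.prems(2) ff(2) insert.prems(5,13)]) (rule that)
  note G = G'[rule_format]
  define N where "N = p * a + q * b"
  have N: "0 < N" using p a b by (simp add: N_def add_pos_pos)
  have R: "0 \<le> R"
  proof -
    have "A \<noteq> {}" using insert.prems(12) by auto
    then obtain x where "x \<in> A" by auto
    then have "x i \<in> {-R..R}" using insert.prems(4) by (intro PiE_mem[of x "insert i I"]) auto
    then show ?thesis by simp
  qed
  have Cfin: "emeasure (leb I) (?s C z) = ennreal (measure (leb I) (?s C z))" for z
  proof (rule emeasure_eq_ennreal_measure)
    have "emeasure (leb I) (?s C z) \<le> ennreal ((2 * R) ^ ?m)"
      using emeasure_mono[OF slice_subset_box[OF insert.prems(6) ff(2)], of "leb I" z] ff R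
      by (simp add: emeasure_leb_box sets_PiM_I_finite)
    then show "emeasure (leb I) (?s C z) \<noteq> top" by (auto simp: top_unique)
  qed
  define h where "h z = measure (leb I) (?s C z) / N ^ ?m" for z
  have hm: "h \<in> borel_measurable borel"
    using measurable_emeasure_slice[OF ff(1) insert.prems(3) ff(2)] unfolding h_def measure_def by measurable
  have h: "min (F x) (G y) \<le> h (p * x + q * y)" if xy: "0 < F x" "0 < G y" for x y
  proof -
    define v where "v = min (F x) (G y)"
    have v: "0 < v" "v \<le> F x" "v \<le> G y" using xy by (auto simp: v_def)
    \<comment> \<open>the sections at heights \<open>x\<close> and \<open>y\<close> have volume at least \<open>(a * r) ^ ?m\<close> and \<open>(b * r) ^ ?m\<close>\<close>
    obtain r where r: "0 < r" "r ^ ?m = v"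
    proof (rule ex_power_eq[OF v(1)])
      show "v = 1" if "?m = 0" using F(6)[OF that xy(1)] G(6)[OF that xy(2)] by (simp add: v_def)
    qed
    have "ennreal ((p * (a * r) + q * (b * r)) ^ ?m) \<le> emeasure (leb I) (?s C (p * x + q * y))"
    proof (rule insert.IH)
      show "?s A x \<in> sets (leb I)" "?s B y \<in> sets (leb I)" "?s C (p * x + q * y) \<in> sets (leb I)"
        using insert.prems ff by (auto intro: measurable_slice)
      show "?s A x \<subseteq> (\<Pi>\<^sub>E i\<in>I. {-R..R})" "?s B y \<subseteq> (\<Pi>\<^sub>E i\<in>I. {-R..R})" "?s C (p * x + q * y) \<subseteq> (\<Pi>\<^sub>E i\<in>I. {-R..R})"
        by (rule slice_subset_box[OF _ ff(2)], rule insert.prems)+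
      show "(\<lambda>j\<in>I. p * u j + q * w j) \<in> ?s C (p * x + q * y)" if "u \<in> ?s A x" "w \<in> ?s B y" for u w
      proof -
        have "(\<lambda>j\<in>insert i I. p * (u(i := x)) j + q * (w(i := y)) j) \<in> C"
          using that by (intro insert.prems(7)) blast+
        moreover have "(\<lambda>j\<in>insert i I. p * (u(i := x)) j + q * (w(i := y)) j) = (\<lambda>j\<in>I. p * u j + q * w j)(i := p * x + q * y)"
          using ff by (auto simp: fun_eq_iff restrict_def)
        ultimately show ?thesis by (simp add: space_PiM)
      qed
      show "ennreal ((a * r) ^ ?m) \<le> emeasure (leb I) (?s A x)" unfolding F(7)
        using a v r by (intro ennreal_leI) (simp add: power_mult_distrib mult_left_mono)
      show "ennreal ((b * r) ^ ?m) \<le> emeasure (leb I) (?s B y)" unfolding G(7)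
        using b v r by (intro ennreal_leI) (simp add: power_mult_distrib mult_left_mono)
      show "0 < emeasure (leb I) (?s A x)" unfolding F(7) using a xy by simp
      show "0 < emeasure (leb I) (?s B y)" unfolding G(7) using b xy by simp
    qed (use a b r in auto)
    then have "(p * (a * r) + q * (b * r)) ^ ?m \<le> measure (leb I) (?s C (p * x + q * y))"
      unfolding Cfin by simp
    moreover have "(p * (a * r) + q * (b * r)) ^ ?m = N ^ ?m * v"
      by (simp add: N_def r(2)[symmetric] power_mult_distrib[symmetric] algebra_simps)
    ultimately have "N ^ ?m * v \<le> measure (leb I) (?s C (p * x + q * y))" by simp
    then show ?thesis using N by (simp add: h_def v_def[symmetric] pos_le_divide_eq mult.commute)
  qed
  have main: "ennreal p * (\<integral>\<^sup>+x. F x \<partial>lborel) + ennreal q * (\<integral>\<^sup>+x. G x \<partial>lborel) \<le> (\<integral>\<^sup>+x. h x \<partial>lborel)"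
    by (rule integral_ge_of_min_ge[where R = R]) (use F G hm p h in auto)
  have cancel: "ennreal (s ^ Suc ?m / a ^ ?m) \<le> X"
    if "ennreal (s ^ Suc ?m) \<le> ennreal (a ^ ?m) * X" "0 \<le> s" "0 < a" for s a X
  proof -
    have "ennreal (1 / a ^ ?m) * ennreal (s ^ Suc ?m) \<le> ennreal (1 / a ^ ?m) * (ennreal (a ^ ?m) * X)"
      using that(1) by (rule mult_left_mono) simp
    also have "\<dots> = ennreal (1 / a ^ ?m * a ^ ?m) * X"
      using that by (subst ennreal_mult') (auto simp: mult.assoc)
    also have "\<dots> = X" using that by simp
    finally show ?thesis using that by (simp add: ennreal_mult'[symmetric])
  qed
  have sF: "ennreal (s ^ Suc ?m / a ^ ?m) \<le> (\<integral>\<^sup>+x. F x \<partial>lborel)"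
    using cancel insert.prems(8,10) ff a F(8) by simp
  have tG: "ennreal (t ^ Suc ?m / b ^ ?m) \<le> (\<integral>\<^sup>+x. G x \<partial>lborel)"
    using cancel insert.prems(9,11) ff b G(8) by simp
  have "ennreal ((p * s + q * t) ^ Suc ?m)
      \<le> ennreal (N ^ ?m * (p * (s ^ Suc ?m / a ^ ?m) + q * (t ^ Suc ?m / b ^ ?m)))"
    unfolding N_def using power_mean_two p a b insert.prems(8,9) by (intro ennreal_leI) blast
  also have "\<dots> = ennreal (N ^ ?m) * (ennreal p * ennreal (s ^ Suc ?m / a ^ ?m) + ennreal q * ennreal (t ^ Suc ?m / b ^ ?m))"
    using N p a b insert.prems(8,9) by (simp add: ennreal_mult'[symmetric] ennreal_plus[symmetric] del: ennreal_plus)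
  also have "\<dots> \<le> ennreal (N ^ ?m) * (ennreal p * (\<integral>\<^sup>+x. F x \<partial>lborel) + ennreal q * (\<integral>\<^sup>+x. G x \<partial>lborel))"
    by (intro mult_left_mono add_mono sF tG) auto
  also have "\<dots> \<le> ennreal (N ^ ?m) * (\<integral>\<^sup>+x. h x \<partial>lborel)"
    by (intro mult_left_mono main) auto
  also have "\<dots> = (\<integral>\<^sup>+x. ennreal (N ^ ?m) * h x \<partial>lborel)"
    using hm by (subst nn_integral_cmult) auto
  also have "\<dots> = (\<integral>\<^sup>+z. emeasure (leb I) (?s C z) \<partial>lborel)"
    using N by (intro nn_integral_cong) (simp add: Cfin h_def ennreal_mult'[symmetric])
  also have "\<dots> = emeasure (leb (insert i I)) C"
    using emeasure_leb_insert[OF ff(1) insert.prems(3) ff(2)] by simp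
  finally show ?case using ff by simp
qed

lemma nn_integral_leb_translate:
  assumes "finite I" "f \<in> borel_measurable (leb I)"
  shows "(\<integral>\<^sup>+w. f (\<lambda>j\<in>I. a j + w j) \<partial>leb I) = (\<integral>\<^sup>+w. f w \<partial>leb I)"
  using nn_integral_leb_affine[OF assms(1), of "\<lambda>j. j" I 1 f a] assms(2) by (simp add: bij_betw_def)

text \<open>
  If one of the two sets is a null set, a dilated translate of the other one is still contained in
  \<open>C\<close>. This degenerate case occurs for the half sections at boundary points of a convex body.
\<close>
lemma brunn_minkowski:
  assumes "finite I" "I \<noteq> {}" "A \<in> sets (leb I)" "B \<in> sets (leb I)" "C \<in> sets (leb I)"
    and "A \<subseteq> (\<Pi>\<^sub>E i\<in>I. {-R..R})" "B \<subseteq> (\<Pi>\<^sub>E i\<in>I. {-R..R})" "C \<subseteq> (\<Pi>\<^sub>E i\<in>I. {-R..R})"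
    and "A \<noteq> {}" "B \<noteq> {}" "0 < p" "0 < q"
    and C: "\<And>x y. x \<in> A \<Longrightarrow> y \<in> B \<Longrightarrow> (\<lambda>i\<in>I. p * x i + q * y i) \<in> C"
  shows "p * root (card I) (measure (leb I) A) + q * root (card I) (measure (leb I) B)
    \<le> root (card I) (measure (leb I) C)"
proof -
  have m: "0 < card I" using assms(1,2) by (simp add: card_gt_0_iff)
  have R: "0 \<le> R"
  proof -
    obtain x where "x \<in> A" using assms(9) by auto
    moreover obtain i where "i \<in> I" using assms(2) by auto
    ultimately have "x i \<in> {-R..R}" using assms(6) by (intro PiE_mem[of x I]) auto
    then show ?thesis by simp
  qed
  have fin: "emeasure (leb I) S = ennreal (measure (leb I) S)" if "S \<subseteq> (\<Pi>\<^sub>E i\<in>I. {-R..R})" for S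
  proof (rule emeasure_eq_ennreal_measure)
    have "emeasure (leb I) S \<le> ennreal ((2 * R) ^ card I)"
      using emeasure_mono[OF that, of "leb I"] assms(1) R by (simp add: emeasure_leb_box sets_PiM_I_finite)
    then show "emeasure (leb I) S \<noteq> top" by (auto simp: top_unique)
  qed
  \<comment> \<open>a single point of one set already translates a scaled copy of the other set into \<open>C\<close>\<close>
  have deg: "r * root (card I) (measure (leb I) T) \<le> root (card I) (measure (leb I) C)"
    if T: "T \<in> sets (leb I)" "T \<subseteq> (\<Pi>\<^sub>E i\<in>I. {-R..R})" and "0 < r"
      and x: "\<And>y. y \<in> T \<Longrightarrow> (\<lambda>i\<in>I. p' * x i + r * y i) \<in> C" for T r p' x
  proof -
    let ?W = "{w \<in> space (leb I). (\<lambda>j\<in>I. - (p' * x j / r) + (1 / r) * w j) \<in> T}"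
    have "?W \<subseteq> C"
    proof
      fix w assume w: "w \<in> ?W"
      then have "(\<lambda>i\<in>I. p' * x i + r * (\<lambda>j\<in>I. - (p' * x j / r) + (1 / r) * w j) i) \<in> C" using x by blast
      also have "(\<lambda>i\<in>I. p' * x i + r * (\<lambda>j\<in>I. - (p' * x j / r) + (1 / r) * w j) i) = w"
        using w \<open>0 < r\<close> by (auto simp: fun_eq_iff restrict_def space_PiM PiE_def extensional_def algebra_simps)
      finally show "w \<in> C" .
    qed
    then have "emeasure (leb I) ?W \<le> emeasure (leb I) C" using assms(5) by (rule emeasure_mono)
    moreover have "emeasure (leb I) T = ennreal (1 / r) ^ card I * emeasure (leb I) ?W"
      using emeasure_leb_affine[OF assms(1), of "\<lambda>j. j" I "1 / r" T "\<lambda>j. - (p' * x j / r)"] T \<open>0 < r\<close> by (simp add: bij_betw_def)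
    ultimately have "emeasure (leb I) T \<le> ennreal (1 / r) ^ card I * emeasure (leb I) C"
      by (simp add: mult_left_mono)
    then have "measure (leb I) T \<le> (1 / r) ^ card I * measure (leb I) C"
      using \<open>0 < r\<close> unfolding fin[OF T(2)] fin[OF assms(8)] by (simp add: ennreal_power ennreal_mult'[symmetric])
    then have "r ^ card I * measure (leb I) T \<le> measure (leb I) C"
      using \<open>0 < r\<close> by (simp add: field_simps)
    then have "root (card I) (r ^ card I * measure (leb I) T) \<le> root (card I) (measure (leb I) C)"
      using m by simp
    then show ?thesis using m \<open>0 < r\<close> by (simp add: real_root_mult real_root_power_cancel)
  qed
  show ?thesis
  proof (cases "measure (leb I) A = 0 \<or> measure (leb I) B = 0")
    case True
    then show ?thesis
    proof
      assume "measure (leb I) A = 0"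
      moreover obtain x where "x \<in> A" using assms(9) by auto
      ultimately show ?thesis using deg[of B q p x] assms by simp
    next
      assume "measure (leb I) B = 0"
      moreover obtain x where "x \<in> B" using assms(10) by auto
      ultimately show ?thesis using deg[of A p q x] assms by (simp add: add.commute)
    qed
  next
    case False
    then have pos: "0 < measure (leb I) A" "0 < measure (leb I) B" by (simp_all add: zero_less_measure_iff)
    have "ennreal ((p * root (card I) (measure (leb I) A) + q * root (card I) (measure (leb I) B)) ^ card I) \<le> emeasure (leb I) C"
      by (rule brunn_minkowski_pos[OF assms(1) assms(3-8) assms(11-13)])
        (use m pos fin[OF assms(6)] fin[OF assms(7)] in auto)
    then have "(p * root (card I) (measure (leb I) A) + q * root (card I) (measure (leb I) B)) ^ card I \<le> measure (leb I) C"
      unfolding fin[OF assms(8)] by simp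
    then have "root (card I) ((p * root (card I) (measure (leb I) A) + q * root (card I) (measure (leb I) B)) ^ card I)
       \<le> root (card I) (measure (leb I) C)" using m by simp
    then show ?thesis using m assms(11,12) by (simp add: real_root_power_cancel)
  qed
qed

section \<open>Lebesgue measure on the span of an orthonormal set\<close>

definition lin_comb :: "'a::real_vector set \<Rightarrow> ('a \<Rightarrow> real) \<Rightarrow> 'a" where
  "lin_comb B f = (\<Sum>b\<in>B. f b *\<^sub>R b)"

lemma lin_comb_add: "lin_comb B (\<lambda>b. f b + g b) = lin_comb B f + lin_comb B g"
  by (simp add: lin_comb_def scaleR_add_left sum.distrib)

lemma lin_comb_diff: "lin_comb B (\<lambda>b. f b - g b) = lin_comb B f - lin_comb B g"
  by (simp add: lin_comb_def scaleR_diff_left sum_subtractf)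

lemma lin_comb_scale: "lin_comb B (\<lambda>b. c * f b) = c *\<^sub>R lin_comb B f"
  by (simp add: lin_comb_def scaleR_sum_right)

lemma lin_comb_restrict [simp]: "lin_comb B (restrict f B) = lin_comb B f"
  by (simp add: lin_comb_def)

lemma lin_comb_in_span: "lin_comb B f \<in> span B"
  by (simp add: lin_comb_def span_sum span_scale span_base)

lemma measurable_lin_comb [measurable]:
  fixes B :: "'a::real_inner set"
  shows "finite B \<Longrightarrow> lin_comb B \<in> measurable (leb B) borel"
  using measurable_lborel_span[of B] by (simp add: lin_comb_def[abs_def])

lemma lborel_span_eq: "lborel_span B = distr (leb B) borel (lin_comb B)"
  by (simp add: lborel_span_def lin_comb_def[abs_def])

lemma nn_integral_lborel_span:
  assumes "finite B" "f \<in> borel_measurable borel"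
  shows "(\<integral>\<^sup>+x. f x \<partial>lborel_span B) = (\<integral>\<^sup>+w. f (lin_comb B w) \<partial>leb B)"
  unfolding lborel_span_eq using assms by (simp add: nn_integral_distr)

lemma sets_lborel_span [simp, measurable_cong]: "sets (lborel_span B) = sets borel"
  by (simp add: lborel_span_def)

lemma space_lborel_span [simp]: "space (lborel_span B) = UNIV"
  by (simp add: lborel_span_def)

lemma emeasure_lborel_span:
  assumes "finite B" "A \<in> sets borel"
  shows "emeasure (lborel_span B) A = emeasure (leb B) {w \<in> space (leb B). lin_comb B w \<in> A}"
  unfolding lborel_span_eq using assms by (simp add: emeasure_distr vimage_def Int_def conj_commute)

lemma orthonormal_inner:
  "orthonormal B \<Longrightarrow> b \<in> B \<Longrightarrow> c \<in> B \<Longrightarrow> b \<bullet> c = (if b = c then 1 else 0)"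
  by (auto simp: orthonormal_def pairwise_def orthogonal_def norm_eq_1)

lemma lin_comb_inner:
  assumes "finite B" "orthonormal B" "b \<in> B"
  shows "lin_comb B f \<bullet> b = f b"
proof -
  have "lin_comb B f \<bullet> b = (\<Sum>c\<in>B. if c = b then f c else 0)"
    unfolding lin_comb_def inner_sum_left using assms
    by (intro sum.cong) (auto simp: orthonormal_inner)
  then show ?thesis using assms by simp
qed

lemma lin_comb_expand:
  assumes "finite B" "orthonormal B" "x \<in> span B"
  shows "lin_comb B (\<lambda>b. x \<bullet> b) = x"
  using orthonormal_basis_expand[of B x] assms by (auto simp: orthonormal_def lin_comb_def)

lemma norm_lin_comb:
  assumes "finite B" "orthonormal B"
  shows "(norm (lin_comb B f))\<^sup>2 = (\<Sum>b\<in>B. (f b)\<^sup>2)"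
  unfolding lin_comb_def using assms
  by (subst norm_sum_Pythagorean) (auto simp: orthonormal_def pairwise_def orthogonal_def)

lemma orthonormal_independent:
  assumes "orthonormal B"
  shows "independent B"
  using assms by (intro pairwise_orthogonal_independent) (auto simp: orthonormal_def)

lemma measurable_pair_lin_comb:
  assumes B: "finite B" "orthonormal B" and B': "finite B'" "B' \<subseteq> span B"
  shows "(\<lambda>p. lin_comb B (fst p) + s *\<^sub>R lin_comb B' (snd p)) \<in> measurable (leb B \<Otimes>\<^sub>M leb B') borel"
proof -
  have sp: "lin_comb B' g \<in> span B" for g
    using lin_comb_in_span[of B' g] span_minimal[OF B'(2)] by auto
  have "(\<lambda>p. \<lambda>b\<in>B. fst p b + s * (\<Sum>c\<in>B'. snd p c * (c \<bullet> b))) \<in> measurable (leb B \<Otimes>\<^sub>M leb B') (leb B)"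
  proof (rule measurable_restrict)
    fix b assume b: "b \<in> B"
    have [measurable]: "(\<lambda>p. fst p b) \<in> borel_measurable (leb B \<Otimes>\<^sub>M leb B')"
      using measurable_compose[OF measurable_fst measurable_component_singleton[OF b, of "\<lambda>_. lborel"]] by simp
    have [measurable]: "(\<lambda>p. snd p c) \<in> borel_measurable (leb B \<Otimes>\<^sub>M leb B')" if "c \<in> B'" for c
      using measurable_compose[OF measurable_snd measurable_component_singleton[OF that, of "\<lambda>_. lborel"]] by simp
    show "(\<lambda>p. fst p b + s * (\<Sum>c\<in>B'. snd p c * (c \<bullet> b))) \<in> measurable (leb B \<Otimes>\<^sub>M leb B') lborel"
      by simp
  qed
  from measurable_compose[OF this measurable_lin_comb[OF B(1)]]
  have "(\<lambda>p. lin_comb B (\<lambda>b. fst p b + s * (\<Sum>c\<in>B'. snd p c * (c \<bullet> b)))) \<in> measurable (leb B \<Otimes>\<^sub>M leb B') borel"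
    by simp
  moreover have "lin_comb B (\<lambda>b. f b + s * (\<Sum>c\<in>B'. g c * (c \<bullet> b))) = lin_comb B f + s *\<^sub>R lin_comb B' g" for f g
    using lin_comb_expand[OF B sp[of g]]
    by (simp add: lin_comb_add lin_comb_scale) (simp add: lin_comb_def inner_sum_left)
  ultimately show ?thesis by simp
qed

lemma emeasure_unit_ball:
  assumes B: "finite B" "orthonormal B"
  shows "{w \<in> space (leb B). lin_comb B w \<in> cball 0 1} = {w \<in> space (leb B). (\<Sum>b\<in>B. (w b)\<^sup>2) \<le> 1}"
    and "0 < emeasure (lborel_span B) (cball 0 1)" "emeasure (lborel_span B) (cball 0 1) < \<infinity>"
proof -
  have iff: "lin_comb B w \<in> cball 0 1 \<longleftrightarrow> (\<Sum>b\<in>B. (w b)\<^sup>2) \<le> 1" for w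
    using abs_square_le_1[of "norm (lin_comb B w)"] by (simp add: norm_lin_comb[OF B])
  then show eq: "{w \<in> space (leb B). lin_comb B w \<in> cball 0 1} = {w \<in> space (leb B). (\<Sum>b\<in>B. (w b)\<^sup>2) \<le> 1}" by simp
  let ?S = "{w \<in> space (leb B). lin_comb B w \<in> cball 0 1}"
  have S: "?S \<in> sets (leb B)"
    by (rule sets_Collect_preimage[OF measurable_lin_comb[OF B(1)]]) simp
  \<comment> \<open>half the side of a cube inside the unit ball; the summand 1 covers the empty basis\<close>
  define r where "r = 1 / (real (card B) + 1)"
  have r: "0 < r" by (simp add: r_def)
  have "(\<Pi>\<^sub>E b\<in>B. {-r..r}) \<subseteq> ?S"
  proof
    fix w assume w: "w \<in> (\<Pi>\<^sub>E b\<in>B. {-r..r})"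
    have wb: "\<bar>w b\<bar> \<le> r" if "b \<in> B" for b using PiE_mem[OF w that] by auto
    have "norm (lin_comb B w) \<le> (\<Sum>b\<in>B. norm (w b *\<^sub>R b))" unfolding lin_comb_def by (rule norm_sum)
    also have "\<dots> \<le> (\<Sum>b\<in>B. r)" using wb B(2) by (intro sum_mono) (auto simp: orthonormal_def)
    also have "\<dots> \<le> 1" by (simp add: r_def)
    finally show "w \<in> ?S" using w by (simp add: space_PiM PiE_iff)
  qed
  then have "emeasure (leb B) (\<Pi>\<^sub>E b\<in>B. {-r..r}) \<le> emeasure (leb B) ?S" using S by (rule emeasure_mono)
  then show "0 < emeasure (lborel_span B) (cball 0 1)"
    using r emeasure_leb_box[OF B(1), of r] order_less_le_trans[of 0 "ennreal ((2 * r) ^ card B)"]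
    by (simp add: emeasure_lborel_span[OF B(1)])
  have "?S \<subseteq> (\<Pi>\<^sub>E b\<in>B. {-1..1})"
  proof
    fix w assume w: "w \<in> ?S"
    have "w b \<in> {-1..1}" if "b \<in> B" for b
    proof -
      have "\<bar>w b\<bar> = \<bar>lin_comb B w \<bullet> b\<bar>" using B that by (simp add: lin_comb_inner)
      also have "\<dots> \<le> norm (lin_comb B w) * norm b" by (rule Cauchy_Schwarz_ineq2)
      also have "\<dots> \<le> 1" using w B(2) that by (simp add: orthonormal_def)
      finally show ?thesis by auto
    qed
    then show "w \<in> (\<Pi>\<^sub>E b\<in>B. {-1..1})" using w by (simp add: space_PiM PiE_iff)
  qed
  then have "emeasure (leb B) ?S \<le> emeasure (leb B) (\<Pi>\<^sub>E b\<in>B. {-1..1})"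
    using B by (intro emeasure_mono) (auto intro!: sets_PiM_I_finite)
  then show "emeasure (lborel_span B) (cball 0 1) < \<infinity>"
    using B emeasure_leb_box[OF B(1), of 1] by (simp add: emeasure_lborel_span order_le_less_trans[OF _ ennreal_less_top])
qed

lemma orthonormal_card_eq:
  assumes "finite B" "orthonormal B" "finite B'" "orthonormal B'" "span B = span B'"
  shows "card B = card B'"
  using assms by (metis dim_span_eq_card_independent orthonormal_independent)

text \<open>
  The argument is the uniqueness of Haar measure. Both measures are invariant under translations
  by the common span and under the reflection; evaluating the integral of
  \<open>indicator A (x + y) * indicator U y\<close> over the product in two ways, for the unit ball \<open>U\<close>, shows
  that the measures of \<open>A\<close> and of \<open>U\<close> are proportional. The factor is \<open>1\<close> because the ball is given
  by the same inequality in the coordinates of either basis.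
\<close>
lemma lborel_span_unique:
  assumes B: "finite B" "orthonormal B" and B': "finite B'" "orthonormal B'" and sp: "span B = span B'"
  shows "lborel_span B = lborel_span B'"
proof (rule measure_eqI)
  fix A assume "A \<in> sets (lborel_span B)"
  then have A [measurable]: "A \<in> sets borel" by simp
  interpret P: pair_sigma_finite "leb B" "leb B'"
    by (simp add: pair_sigma_finite_def sigma_finite_leb B B')
  note [measurable] = measurable_lin_comb[OF B(1)] measurable_lin_comb[OF B'(1)]
  let ?U = "cball 0 1 :: 'a set"
  have U [measurable]: "?U \<in> sets borel" by simp
  have sB: "lin_comb B f \<in> span B'" for f using lin_comb_in_span[of B f] sp by simp
  have sB': "lin_comb B' f \<in> span B" for f using lin_comb_in_span[of B' f] sp by simp
  have "B' \<subseteq> span B" "B \<subseteq> span B'" using sp span_superset by blast+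
  have pm: "(\<lambda>p. lin_comb B (fst p) + s *\<^sub>R lin_comb B' (snd p)) \<in> measurable (leb B \<Otimes>\<^sub>M leb B') borel" for s
    by (rule measurable_pair_lin_comb) fact+
  have pm_add [measurable]: "(\<lambda>p. lin_comb B (fst p) + lin_comb B' (snd p)) \<in> measurable (leb B \<Otimes>\<^sub>M leb B') borel"
    using pm[of 1] by simp
  have pm_diff [measurable]: "(\<lambda>p. lin_comb B' (snd p) - lin_comb B (fst p)) \<in> measurable (leb B \<Otimes>\<^sub>M leb B') borel"
    using measurable_compose[OF pm[of "-1"], of "\<lambda>x. - x" borel]
    by (simp add: borel_measurable_continuous_onI continuous_intros)
  have pm_snd [measurable]: "(\<lambda>p. lin_comb B' (snd p)) \<in> measurable (leb B \<Otimes>\<^sub>M leb B') borel"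
    using measurable_compose[OF measurable_snd measurable_lin_comb[OF B'(1)]] .
  have shift: "(\<lambda>w. c *\<^sub>R lin_comb D w + x) \<in> measurable (leb D) borel" if "finite D" for D :: "'a set" and x c
    using measurable_compose[OF measurable_lin_comb[OF that], of "\<lambda>v. c *\<^sub>R v + x" borel]
    by (simp add: borel_measurable_continuous_onI continuous_intros)
  let ?\<mu> = "\<lambda>S. emeasure (lborel_span B) S" and ?\<nu> = "\<lambda>S. emeasure (lborel_span B') S"
  have i\<mu>: "?\<mu> S = (\<integral>\<^sup>+f. indicator S (lin_comb B f) \<partial>leb B)" if "S \<in> sets borel" for S
    using nn_integral_lborel_span[OF B(1), of "indicator S"] that by simp
  have i\<nu>: "?\<nu> S = (\<integral>\<^sup>+f. indicator S (lin_comb B' f) \<partial>leb B')" if "S \<in> sets borel" for S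
    using nn_integral_lborel_span[OF B'(1), of "indicator S"] that by simp
  have "?\<mu> A * ?\<nu> ?U = (\<integral>\<^sup>+g. ?\<mu> A * indicator ?U (lin_comb B' g) \<partial>leb B')"
    unfolding i\<nu>[OF U] by (rule nn_integral_cmult[symmetric]) measurable
  \<comment> \<open>the measure of \<open>B\<close> is invariant under translation by \<open>lin_comb B' g\<close>\<close>
  also have "\<dots> = (\<integral>\<^sup>+g. \<integral>\<^sup>+f. indicator A (lin_comb B f + lin_comb B' g) * indicator ?U (lin_comb B' g) \<partial>leb B \<partial>leb B')"
  proof (rule nn_integral_cong)
    fix g
    have [measurable]: "(\<lambda>w. lin_comb B w + lin_comb B' g) \<in> measurable (leb B) borel" using shift[OF B(1), of 1] by simp
    have "(\<integral>\<^sup>+f. indicator A (lin_comb B f + lin_comb B' g) \<partial>leb B)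
        = (\<integral>\<^sup>+f. indicator A (lin_comb B (\<lambda>b\<in>B. lin_comb B' g \<bullet> b + f b)) \<partial>leb B)"
      using lin_comb_expand[OF B sB'[of g]] by (simp add: lin_comb_add add.commute)
    also have "\<dots> = ?\<mu> A"
      using nn_integral_leb_translate[OF B(1), of "\<lambda>w. indicator A (lin_comb B w)" "\<lambda>b. lin_comb B' g \<bullet> b"]
        measurable_lin_comb[OF B(1)]
      by (simp add: i\<mu>)
    finally show "?\<mu> A * indicator ?U (lin_comb B' g) = (\<integral>\<^sup>+f. indicator A (lin_comb B f + lin_comb B' g) * indicator ?U (lin_comb B' g) \<partial>leb B)"
      by (subst nn_integral_multc) (auto)
  qed
  also have "\<dots> = (\<integral>\<^sup>+f. \<integral>\<^sup>+g. indicator A (lin_comb B f + lin_comb B' g) * indicator ?U (lin_comb B' g) \<partial>leb B' \<partial>leb B)"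
    by (rule P.Fubini') (simp add: split_beta')
  \<comment> \<open>the measure of \<open>B'\<close> is invariant under translation by \<open>lin_comb B f\<close>\<close>
  also have "\<dots> = (\<integral>\<^sup>+f. \<integral>\<^sup>+g. indicator A (lin_comb B' g) * indicator ?U (lin_comb B' g - lin_comb B f) \<partial>leb B' \<partial>leb B)"
  proof (rule nn_integral_cong)
    fix f
    have [measurable]: "(\<lambda>w. lin_comb B' w - lin_comb B f) \<in> measurable (leb B') borel"
      using shift[OF B'(1), of 1 "- lin_comb B f"] by simp
    let ?h = "\<lambda>g. indicator A (lin_comb B' g) * indicator ?U (lin_comb B' g - lin_comb B f) :: ennreal"
    have "(\<integral>\<^sup>+g. ?h g \<partial>leb B') = (\<integral>\<^sup>+g. ?h (\<lambda>b\<in>B'. lin_comb B f \<bullet> b + g b) \<partial>leb B')"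
      using measurable_lin_comb[OF B'(1)] by (intro nn_integral_leb_translate[symmetric] B') simp
    also have "\<dots> = (\<integral>\<^sup>+g. indicator A (lin_comb B f + lin_comb B' g) * indicator ?U (lin_comb B' g) \<partial>leb B')"
      using lin_comb_expand[OF B' sB[of f]] by (simp add: lin_comb_add)
    finally show "(\<integral>\<^sup>+g. indicator A (lin_comb B f + lin_comb B' g) * indicator ?U (lin_comb B' g) \<partial>leb B') = (\<integral>\<^sup>+g. ?h g \<partial>leb B')" ..
  qed
  also have "\<dots> = (\<integral>\<^sup>+g. \<integral>\<^sup>+f. indicator A (lin_comb B' g) * indicator ?U (lin_comb B' g - lin_comb B f) \<partial>leb B \<partial>leb B')"
    by (rule P.Fubini'[symmetric]) (simp add: split_beta')
  \<comment> \<open>the measure of \<open>B\<close> is invariant under reflection in a point\<close>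
  also have "\<dots> = (\<integral>\<^sup>+g. indicator A (lin_comb B' g) * ?\<mu> ?U \<partial>leb B')"
  proof (rule nn_integral_cong)
    fix g
    have [measurable]: "(\<lambda>w. lin_comb B' g - lin_comb B w) \<in> measurable (leb B) borel"
      using shift[OF B(1), of "-1" "lin_comb B' g"] by simp
    let ?h = "\<lambda>f. indicator ?U (lin_comb B' g - lin_comb B f) :: ennreal"
    have e: "lin_comb B' g - lin_comb B (\<lambda>b\<in>B. lin_comb B' g \<bullet> b + (-1) * f b) = lin_comb B f" for f
      using lin_comb_expand[OF B sB'[of g]] lin_comb_diff[of B "\<lambda>b. lin_comb B' g \<bullet> b" f] by simp
    have "(\<integral>\<^sup>+f. ?h f \<partial>leb B) = (\<integral>\<^sup>+f. ?h (\<lambda>b\<in>B. lin_comb B' g \<bullet> b + (-1) * f b) \<partial>leb B)"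
      using nn_integral_leb_affine[OF B(1), of "\<lambda>j. j" B "-1" ?h "\<lambda>b. lin_comb B' g \<bullet> b"] by (simp add: bij_betw_def)
    also have "\<dots> = ?\<mu> ?U" unfolding e by (simp add: i\<mu>)
    finally have "(\<integral>\<^sup>+f. ?h f \<partial>leb B) = ?\<mu> ?U" .
    then show "(\<integral>\<^sup>+f. indicator A (lin_comb B' g) * ?h f \<partial>leb B) = indicator A (lin_comb B' g) * ?\<mu> ?U"
      by (subst nn_integral_cmult) auto
  qed
  also have "\<dots> = ?\<nu> A * ?\<mu> ?U"
    using measurable_lin_comb[OF B'(1)] by (subst nn_integral_multc) (auto simp: i\<nu>)
  finally have main: "?\<mu> A * ?\<nu> ?U = ?\<nu> A * ?\<mu> ?U" .
  obtain e where e: "bij_betw e B' B"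
    using orthonormal_card_eq[OF B B' sp] B B' by (metis finite_same_card_bij)
  have S': "{w \<in> space (leb B'). (\<Sum>b\<in>B'. (w b)\<^sup>2) \<le> 1} \<in> sets (leb B')"
    using sets_Collect_preimage[OF measurable_lin_comb[OF B'(1)] U] unfolding emeasure_unit_ball(1)[OF B'] .
  have "?\<nu> ?U = emeasure (leb B') {w \<in> space (leb B'). (\<Sum>b\<in>B'. (w b)\<^sup>2) \<le> 1}"
    unfolding emeasure_lborel_span[OF B'(1) U] emeasure_unit_ball(1)[OF B'] ..
  also have "\<dots> = emeasure (leb B) {w \<in> space (leb B). (\<lambda>j\<in>B'. 0 + 1 * w (e j)) \<in> {w \<in> space (leb B'). (\<Sum>b\<in>B'. (w b)\<^sup>2) \<le> 1}}"
    using emeasure_leb_affine[OF B(1) e _ S', of 1 "\<lambda>_. 0"] by simp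
  also have "{w \<in> space (leb B). (\<lambda>j\<in>B'. 0 + 1 * w (e j)) \<in> {w \<in> space (leb B'). (\<Sum>b\<in>B'. (w b)\<^sup>2) \<le> 1}}
      = {w \<in> space (leb B). (\<Sum>b\<in>B. (w b)\<^sup>2) \<le> 1}"
    using sum.reindex_bij_betw[OF e, of "\<lambda>b. (w b :: real)\<^sup>2" for w] by (auto simp: space_PiM)
  also have "emeasure (leb B) \<dots> = ?\<mu> ?U"
    unfolding emeasure_lborel_span[OF B(1) U] emeasure_unit_ball(1)[OF B] ..
  finally have "?\<mu> ?U * ?\<mu> A = ?\<mu> ?U * ?\<nu> A" using main by (simp add: mult.commute)
  then show "?\<mu> A = ?\<nu> A"
    using emeasure_unit_ball(2,3)[OF B] by (auto simp: ennreal_mult_cancel_left)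
qed simp


lemma emeasure_lborel_span_hyperplane:
  assumes B: "finite B" and c: "c \<in> B" "a \<bullet> c \<noteq> 0"
  shows "emeasure (lborel_span B) {x. a \<bullet> x = 0} = 0"
proof -
  interpret L: product_sigma_finite "\<lambda>_. lborel :: real measure" by (rule product_sigma_finite_lborel)
  define D where "D = B - {c}"
  have D: "finite D" "c \<notin> D" "B = insert c D" using B c by (auto simp: D_def)
  have H [measurable]: "{x. a \<bullet> x = 0} \<in> sets borel"
    by (intro borel_closed closed_Collect_eq continuous_intros)
  have "emeasure (lborel_span B) {x. a \<bullet> x = 0} = (\<integral>\<^sup>+w. indicator {x. a \<bullet> x = 0} (lin_comb B w) \<partial>leb B)"
    using nn_integral_lborel_span[OF B, of "indicator {x. a \<bullet> x = 0}"] by simp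
  also have "\<dots> = (\<integral>\<^sup>+x. (\<integral>\<^sup>+t. indicator {x. a \<bullet> x = 0} (lin_comb B (x(c := t))) \<partial>lborel) \<partial>leb D)"
    unfolding D(3)
    by (rule L.product_nn_integral_insert[OF D(1,2)]) (use measurable_compose[OF measurable_lin_comb[OF B] borel_measurable_indicator[OF H]] D(3) in simp)
  also have "\<dots> = (\<integral>\<^sup>+x. 0 \<partial>leb D)"
  proof (rule nn_integral_cong)
    fix x
    have e: "lin_comb B (x(c := t)) = t *\<^sub>R c + lin_comb D x" for t
      using D by (auto simp: lin_comb_def intro!: sum.cong)
    have "(\<integral>\<^sup>+t. indicator {x. a \<bullet> x = 0} (lin_comb B (x(c := t))) \<partial>lborel)
        = (\<integral>\<^sup>+t. indicator {- (a \<bullet> lin_comb D x) / (a \<bullet> c)} t \<partial>lborel)"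
      using c(2) by (intro nn_integral_cong) (auto simp: e indicator_def inner_add_right field_simps add_eq_0_iff)
    also have "\<dots> = 0" by simp
    finally show "(\<integral>\<^sup>+t. indicator {x. a \<bullet> x = 0} (lin_comb B (x(c := t))) \<partial>lborel) = 0" .
  qed
  finally show ?thesis by simp
qed

text \<open>
  Some \<open>c \<in> B\<close> is not in the span of \<open>B'\<close>; its component \<open>a\<close> orthogonal to that span has
  \<open>a \<bullet> c \<noteq> 0\<close> and is orthogonal to all of \<open>A\<close>.
\<close>
lemma null_if_spanned_elsewhere:
  assumes B: "finite B" "orthonormal B" and B': "finite B'" "orthonormal B'" and card: "card B = card B'"
    and sp: "span B \<noteq> span B'" and A: "A \<subseteq> span B'"
  shows "measure (lborel_span B) A = 0"
proof -
  have "\<not> B \<subseteq> span B'"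
  proof
    assume "B \<subseteq> span B'"
    have "B' \<subseteq> span B"
    proof
      fix b assume "b \<in> B'"
      show "b \<in> span B"
      proof (rule ccontr)
        assume b: "b \<notin> span B"
        then have "independent (insert b B)"
          using orthonormal_independent[OF B(2)] by (intro independent_insertI)
        moreover have "insert b B \<subseteq> span B'" using \<open>B \<subseteq> span B'\<close> \<open>b \<in> B'\<close> by (simp add: span_base)
        ultimately have "card (insert b B) \<le> card B'" using independent_span_bound[OF B'(1)] by blast
        moreover have "b \<notin> B" using b by (auto simp: span_base)
        ultimately show False using card B(1) by simp
      qed
    qed
    then have "span B' \<subseteq> span B" by (meson span_minimal subspace_span)
    with \<open>B \<subseteq> span B'\<close> sp show False by (meson span_minimal subspace_span subset_antisym)
  qed
  then obtain c where c: "c \<in> B" "c \<notin> span B'" by auto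
  define a where "a = c - lin_comb B' (\<lambda>b. c \<bullet> b)"
  have "a \<bullet> b = 0" if "b \<in> B'" for b
    using B' that by (simp add: a_def inner_diff_left lin_comb_inner)
  then have a0: "a \<bullet> x = 0" if "x \<in> span B'" for x
    using orthogonal_to_span[OF that, of a] by (simp add: orthogonal_def)
  have "a \<noteq> 0" using c(2) lin_comb_in_span[of B' "\<lambda>b. c \<bullet> b"] by (auto simp: a_def)
  moreover have "a \<bullet> c = a \<bullet> a"
    using a0[OF lin_comb_in_span[of B' "\<lambda>b. c \<bullet> b"]] by (simp add: a_def inner_diff_right)
  ultimately have "a \<bullet> c \<noteq> 0" by simp
  then have "emeasure (lborel_span B) {x. a \<bullet> x = 0} = 0"
    by (rule emeasure_lborel_span_hyperplane[OF B(1) c(1)])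
  moreover have "{x. a \<bullet> x = 0} \<in> sets borel"
    by (intro borel_closed closed_Collect_eq continuous_intros)
  moreover have "A \<subseteq> {x. a \<bullet> x = 0}" using A a0 by auto
  ultimately have "emeasure (lborel_span B) A = 0"
    by (metis emeasure_mono le_zero_eq sets_lborel_span)
  then show ?thesis by (simp add: measure_def)
qed

text \<open>
  The choice hidden in \<^const>\<open>vol\<close> may pick a basis of another subspace, but then \<open>A\<close> is a null set
  for both measures.
\<close>
lemma vol_eq_measure:
  assumes B: "finite B" "orthonormal B" and A: "A \<subseteq> span B"
  shows "vol (card B) A = measure (lborel_span B) A"
proof -
  define B' where "B' = (SOME B'. finite B' \<and> card B' = card B \<and> orthonormal B' \<and> A \<subseteq> span B')"
  have B': "finite B'" "card B' = card B" "orthonormal B'" "A \<subseteq> span B'"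
    using someI[of "\<lambda>B'. finite B' \<and> card B' = card B \<and> orthonormal B' \<and> A \<subseteq> span B'" B] assms
    unfolding B'_def by auto
  have "measure (lborel_span B') A = measure (lborel_span B) A"
  proof (cases "span B = span B'")
    case True
    then show ?thesis using lborel_span_unique[of B B'] B B' by simp
  next
    case False
    then show ?thesis using null_if_spanned_elsewhere[of B B' A] null_if_spanned_elsewhere[of B' B A] B B' A by metis
  qed
  then show ?thesis by (simp add: vol_def B'_def)
qed

section \<open>The distribution of upper tails\<close>

text \<open>
  The points whose upper tail is small form themselves an upper tail, or an increasing union of
  upper tails when the admissible levels have no least element.
\<close>
lemma emeasure_upper_tail_le:
  fixes t :: "'a \<Rightarrow> real"
  assumes S: "S \<in> sets M" and [measurable]: "t \<in> borel_measurable M"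
  shows "emeasure M {x \<in> S. emeasure M {y \<in> S. t x \<le> t y} \<le> e} \<le> e"
    and "{x \<in> S. emeasure M {y \<in> S. t x \<le> t y} \<le> e} \<in> sets M"
proof -
  define U where "U r = {y \<in> S. r \<le> t y}" for r
  have Um: "U r \<in> sets M" for r
  proof -
    have "U r = S \<inter> {y \<in> space M. r \<le> t y}" using sets.sets_into_space[OF S] by (auto simp: U_def)
    then show ?thesis using S by simp
  qed
  have mono: "emeasure M (U r) \<le> emeasure M (U q)" if "q \<le> r" for q r
    using that Um by (intro emeasure_mono) (auto simp: U_def)
  let ?G = "{x \<in> S. emeasure M (U (t x)) \<le> e}"
  have "emeasure M ?G \<le> e \<and> ?G \<in> sets M"
  proof (cases "?G = {}")
    case True
    show ?thesis unfolding True by simp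
  next
    case False
    \<comment> \<open>the admissible levels form an up-closed set, generated by its minimum or by a decreasing sequence\<close>
    define T where "T = {r. emeasure M (U r) \<le> e}"
    have G: "?G = {x \<in> S. t x \<in> T}" by (auto simp: T_def)
    have up: "r \<in> T" if "q \<in> T" "q \<le> r" for q r using that mono[of q r] by (auto simp: T_def)
    from False obtain q0 where q0: "q0 \<in> T" by (auto simp: T_def)
    show ?thesis
    proof (cases "\<exists>q\<in>T. \<forall>r\<in>T. q \<le> r")
      case True
      then obtain q where "q \<in> T" "\<forall>r\<in>T. q \<le> r" by auto
      then have "?G = U q" unfolding G by (auto simp: U_def intro: up[OF \<open>q \<in> T\<close>])
      then show ?thesis using \<open>q \<in> T\<close> Um by (simp add: T_def)
    next
      case nomin: False
      have "\<exists>q::nat \<Rightarrow> real. decseq q \<and> (\<forall>n. q n \<in> T) \<and> (\<forall>r\<in>T. \<exists>n. q n \<le> r)"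
      proof (cases "bdd_below T")
        case True
        have inf: "Inf T < r" if "r \<in> T" for r
        proof -
          from nomin that obtain r' where "r' \<in> T" "r' < r" by force
          then show ?thesis using cInf_lower[OF _ True, of r'] by linarith
        qed
        have inT: "r \<in> T" if "Inf T < r" for r
          using cInf_lessD[of T r] q0 that up by (metis empty_iff less_imp_le)
        show ?thesis
        proof (intro exI[of _ "\<lambda>n. Inf T + 1 / real (Suc n)"] conjI ballI allI)
          show "decseq (\<lambda>n. Inf T + 1 / real (Suc n))" by (auto simp: decseq_def field_simps)
          show "Inf T + 1 / real (Suc n) \<in> T" for n by (rule inT) simp
          show "\<exists>n. Inf T + 1 / real (Suc n) \<le> r" if "r \<in> T" for r
          proof -
            have "0 < r - Inf T" using inf[OF that] by simp
            then obtain n where "1 / real (Suc n) < r - Inf T" by (rule nat_approx_posE)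
            then show ?thesis by (intro exI[of _ n]) simp
          qed
        qed
      next
        case unb: False
        have inT: "r \<in> T" for r
          using unb up by (metis bdd_below.I linorder_le_cases)
        show ?thesis
        proof (intro exI[of _ "\<lambda>n. - real n"] conjI ballI allI)
          show "\<exists>n. - real n \<le> r" for r using real_arch_simple[of "- r"] by (auto simp: minus_le_iff)
        qed (auto simp: decseq_def inT)
      qed
      then obtain q :: "nat \<Rightarrow> real" where q: "decseq q" "\<And>n. q n \<in> T" "\<And>r. r \<in> T \<Longrightarrow> \<exists>n. q n \<le> r" by blast
      have GU: "?G = (\<Union>n. U (q n))" unfolding G by (auto simp: U_def intro: up[OF q(2)] dest: q(3))
      have "(SUP n. emeasure M (U (q n))) = emeasure M (\<Union>n. U (q n))"
      proof (rule SUP_emeasure_incseq)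
        show "incseq (\<lambda>n. U (q n))"
        proof (rule incseq_SucI)
          fix n show "U (q n) \<subseteq> U (q (Suc n))" using decseq_SucD[OF q(1), of n] by (auto simp: U_def)
        qed
      qed (use Um in auto)
      moreover have "(SUP n. emeasure M (U (q n))) \<le> e" using q(2) by (intro SUP_least) (simp add: T_def)
      ultimately show ?thesis using Um unfolding GU by auto
    qed
  qed
  then show "emeasure M {x \<in> S. emeasure M {y \<in> S. t x \<le> t y} \<le> e} \<le> e"
    and "{x \<in> S. emeasure M {y \<in> S. t x \<le> t y} \<le> e} \<in> sets M"
    unfolding U_def by auto
qed

text \<open>
  If \<open>t\<close> has no atoms, the tail volume of a random point of \<open>S\<close> is uniformly distributed on
  \<open>[0, J ^ m]\<close>, and the expectation of its \<open>m\<close>-th root gives the constant. In general the tail volume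
  is stochastically at least uniform, hence the inequality. Integrating over the levels \<open>r\<close> of the
  root, rather than over those of the volume, leaves only the polynomial \<open>J ^ m - r ^ m\<close> to
  integrate.
\<close>
lemma nn_integral_upper_tail:
  fixes t :: "'a \<Rightarrow> real"
  assumes sf: "sigma_finite_measure M" and S: "S \<in> sets M" and fin: "emeasure M S < \<infinity>"
    and t: "t \<in> borel_measurable M" and m: "0 < m"
  defines "J \<equiv> root m (measure M S)"
  shows "ennreal (real m / (real m + 1) * J ^ (m + 1))
    \<le> (\<integral>\<^sup>+x. indicator S x * ennreal (root m (measure M {y \<in> S. t x \<le> t y})) \<partial>M)"
proof -
  note [measurable] = S t
  define u where "u x = measure M {y \<in> S. t x \<le> t y}" for x
  have J: "0 \<le> J" "J ^ m = measure M S" using m by (simp_all add: J_def)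
  have Sfin: "emeasure M S = ennreal (J ^ m)" using fin J by (simp add: emeasure_eq_ennreal_measure less_top)
  have eu: "emeasure M {y \<in> S. t x \<le> t y} = ennreal (u x)" for x
  proof -
    have "emeasure M {y \<in> S. t x \<le> t y} \<le> emeasure M S" using S by (intro emeasure_mono) auto
    with fin show ?thesis unfolding u_def by (intro emeasure_eq_ennreal_measure) (auto simp: top_unique)
  qed
  define g where "g x = indicat_real S x * root m (u x)" for x
  have tail: "emeasure M {x \<in> S. u x \<le> e} \<le> ennreal e" "{x \<in> S. u x \<le> e} \<in> sets M" if "0 \<le> e" for e
    using emeasure_upper_tail_le[OF S t, of "ennreal e"] that unfolding eu by simp_all
  have u0: "0 \<le> u x" for x by (simp add: u_def)
  have rt: "e < root m (u x) \<longleftrightarrow> e ^ m < u x" if "0 \<le> e" for e x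
    using real_root_less_iff[OF m, of "e ^ m" "u x"] real_root_power_cancel[OF m that] by simp
  have gm: "g \<in> borel_measurable M"
  proof (rule borel_measurableI_greater)
    fix e :: real
    show "{x \<in> space M. e < g x} \<in> sets M"
    proof (cases "0 \<le> e")
      case True
      have "{x \<in> space M. e < g x} = S - {x \<in> S. u x \<le> e ^ m}"
        using True m u0 sets.sets_into_space[OF S]
        by (auto simp: g_def indicator_def not_le rt split: if_splits)
      then show ?thesis using tail(2)[of "e ^ m"] True S by simp
    next
      case False
      then have "{x \<in> space M. e < g x} = space M" using m u0
        by (auto simp: g_def indicator_def intro: less_le_trans[of e 0])
      then show ?thesis by simp
    qed
  qed
  have level: "ennreal (J ^ m - r ^ m) \<le> emeasure M {x \<in> space M. r < g x}" if r: "0 \<le> r" for r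
  proof -
    have "{x \<in> space M. r < g x} = S - {x \<in> S. u x \<le> r ^ m}"
        using r m u0 sets.sets_into_space[OF S]
        by (auto simp: g_def indicator_def not_le rt split: if_splits)
    then have "emeasure M {x \<in> space M. r < g x} = emeasure M S - emeasure M {x \<in> S. u x \<le> r ^ m}"
      using tail[of "r ^ m"] r S by (subst emeasure_Diff[symmetric]) (auto simp: top_unique)
    also have "\<dots> \<ge> ennreal (J ^ m) - ennreal (r ^ m)"
      unfolding Sfin using tail[of "r ^ m"] r by (intro ennreal_mono_minus) auto
    finally show ?thesis using r by (simp add: ennreal_minus)
  qed
  have "ennreal (real m / (real m + 1) * J ^ (m + 1)) = (\<integral>\<^sup>+r. ennreal (J ^ m - r ^ m) * indicator {0..J} r \<partial>lborel)"
  proof -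
    have "(\<integral>\<^sup>+r. ennreal (J ^ m - r ^ m) * indicator {0..J} r \<partial>lborel)
      = ennreal ((J ^ m * J - J ^ Suc m / real (Suc m)) - (J ^ m * 0 - 0 ^ Suc m / real (Suc m)))"
      using J(1) by (intro nn_integral_FTC_Icc) (auto intro!: derivative_eq_intros power_mono simp del: power_Suc)
    also have "(J ^ m * J - J ^ Suc m / real (Suc m)) - (J ^ m * 0 - 0 ^ Suc m / real (Suc m)) = real m / (real m + 1) * J ^ (m + 1)"
      by (simp add: field_simps)
    finally show ?thesis by simp
  qed
  also have "\<dots> \<le> (\<integral>\<^sup>+r. indicator {0..} r * emeasure M {x \<in> space M. r < g x} \<partial>lborel)"
    using level by (intro nn_integral_mono) (auto simp: indicator_def)
  also have "\<dots> = (\<integral>\<^sup>+x. ennreal (g x) \<partial>M)"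
    by (rule nn_integral_layer_cake[OF sf gm, symmetric])
  also have "\<dots> = (\<integral>\<^sup>+x. indicator S x * ennreal (root m (measure M {y \<in> S. t x \<le> t y})) \<partial>M)"
    by (intro nn_integral_cong) (auto simp: g_def u_def indicator_def)
  finally show ?thesis .
qed

section \<open>Convex bodies sliced by a subspace\<close>

text \<open>
  The point of \<open>G\<close> nearest to the barycentre supplies a separating hyperplane; integrating the
  separating inequality shows that the distance is \<open>0\<close>. Compactness of \<open>G\<close> provides the nearest
  point, as finitely supported sequences do not form a complete space.
\<close>
lemma barycenter_in_compact_convex:
  fixes G :: "'b::real_inner set" and X :: "'a \<Rightarrow> 'b"
  assumes G: "compact G" "convex G" and K: "K \<in> sets M" "0 < emeasure M K" "emeasure M K < \<infinity>"
    and X: "\<And>x. x \<in> K \<Longrightarrow> X x \<in> G"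
    and int: "\<And>v. integrable M (\<lambda>x. indicator K x * (X x \<bullet> v))"
    and c: "\<And>v. (\<integral>x. indicator K x * (X x \<bullet> v) \<partial>M) = measure M K * (c \<bullet> v)"
  shows "c \<in> G"
proof -
  have "K \<noteq> {}" using K by auto
  then have "G \<noteq> {}" using X by auto
  moreover have "continuous_on G (\<lambda>x. dist c x)" by (intro continuous_intros)
  ultimately obtain p where p: "p \<in> G" "\<And>y. y \<in> G \<Longrightarrow> dist c p \<le> dist c y"
    using continuous_attains_inf[OF G(1)] by meson
  have le: "X x \<bullet> (c - p) \<le> p \<bullet> (c - p)" if "x \<in> K" for x
    using any_closest_point_dot[OF G(2) compact_imp_closed[OF G(1)] p(1) X[OF that], of c] p(2)
    by (auto simp: inner_diff_right inner_diff_left inner_commute)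
  have K0: "0 < measure M K"
    using K(2,3) by (simp add: emeasure_eq_ennreal_measure less_top)
  have "(\<integral>x. indicator K x * (X x \<bullet> (c - p)) \<partial>M) \<le> (\<integral>x. indicator K x * (p \<bullet> (c - p)) \<partial>M)"
  proof (rule integral_mono)
    show "integrable M (\<lambda>x. indicator K x * (p \<bullet> (c - p)))"
      using K by (intro integrable_mult_left integrable_real_indicator) auto
  qed (use int[of "c - p"] le in \<open>auto simp: indicator_def\<close>)
  also have "\<dots> = measure M K * (p \<bullet> (c - p))" using K sets.sets_into_space[OF K(1)] by (simp add: Int_absorb2)
  finally have "measure M K * ((c - p) \<bullet> (c - p)) \<le> 0"
    unfolding c by (simp add: inner_diff_left inner_diff_right algebra_simps)
  then have "(c - p) \<bullet> (c - p) \<le> 0" using K0 by (simp add: mult_le_0_iff)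
  then have "c = p" by (metis inner_ge_zero inner_eq_zero_iff order_antisym right_minus_eq)
  then show ?thesis using p by simp
qed

lemma emeasure_lborel_span_bounded:
  assumes B: "finite B" "orthonormal B" and K: "K \<in> sets borel" "\<And>x. x \<in> K \<Longrightarrow> norm x \<le> R" and R: "0 \<le> R"
  shows "emeasure (lborel_span B) K < \<infinity>"
proof -
  have "{w \<in> space (leb B). lin_comb B w \<in> K} \<subseteq> (\<Pi>\<^sub>E b\<in>B. {-R..R})"
  proof
    fix w assume w: "w \<in> {w \<in> space (leb B). lin_comb B w \<in> K}"
    have "w b \<in> {-R..R}" if "b \<in> B" for b
    proof -
      have "\<bar>w b\<bar> = \<bar>lin_comb B w \<bullet> b\<bar>" using B that by (simp add: lin_comb_inner)
      also have "\<dots> \<le> norm (lin_comb B w) * norm b" by (rule Cauchy_Schwarz_ineq2)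
      also have "\<dots> \<le> R" using w B that K(2) by (simp add: orthonormal_def)
      finally show ?thesis by auto
    qed
    then show "w \<in> (\<Pi>\<^sub>E b\<in>B. {-R..R})" using w by (simp add: space_PiM PiE_iff)
  qed
  then have "emeasure (lborel_span B) K \<le> emeasure (leb B) (\<Pi>\<^sub>E b\<in>B. {-R..R})"
    using B K(1) by (subst emeasure_lborel_span) (auto intro!: emeasure_mono sets_PiM_I_finite)
  also have "\<dots> < \<infinity>" using emeasure_leb_box[OF B(1) R] by simp
  finally show ?thesis .
qed

text \<open>
  The ambient space \<open>span (C \<union> D)\<close> is the orthogonal sum of the subspace \<open>span C\<close>, along which the
  body \<open>K\<close> is cut, and of \<open>span D\<close>, which parametrises the parallel slices. The unit vector \<open>\<eta>\<close>
  cuts the slice through the origin into two halves. The assumption \<open>cent\<close> says that the centroid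
  of \<open>K\<close> is the origin.
\<close>
locale sliced_body =
  fixes C D K :: "'a::real_inner set" and \<eta> :: 'a
  assumes fin: "finite C" "finite D" and disj: "C \<inter> D = {}" and on: "orthonormal (C \<union> D)"
    and K: "compact K" "convex K" "K \<subseteq> span (C \<union> D)" and \<eta>: "\<eta> \<in> C"
    and pos: "0 < emeasure (lborel_span (C \<union> D)) K"
    and cent: "\<And>v. (\<integral>x. indicator K x * (x \<bullet> v) \<partial>lborel_span (C \<union> D)) = 0"
begin

abbreviation "m \<equiv> card C"
abbreviation "d \<equiv> card D"

lemma m_pos: "0 < m" using fin \<eta> by (auto simp: card_gt_0_iff)

lemma onC: "orthonormal C"
  using on by (auto simp: orthonormal_def pairwise_def)

text \<open>
  The section \<open>K \<inter> (y + span C)\<close> in the coordinates of \<open>span C\<close>, centred at \<open>y\<close> and restricted by a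
  condition on the \<open>\<eta>\<close>-coordinate. With \<open>T = UNIV\<close> it is the full section, with \<open>T = {0..}\<close> the
  half of the section on the side of \<open>y\<close> to which \<open>\<eta>\<close> points.
\<close>
definition sect :: "real set \<Rightarrow> 'a \<Rightarrow> ('a \<Rightarrow> real) set" where
  "sect T y = {w \<in> space (leb C). y + lin_comb C w \<in> K \<and> w \<eta> \<in> T}"

text \<open>Up to a constant factor this is the volume radius of the section.\<close>
definition vrad :: "real set \<Rightarrow> 'a \<Rightarrow> real" where
  "vrad T y = root m (measure (leb C) (sect T y))"

definition R :: real where "R = (SOME r. 0 < r \<and> (\<forall>x\<in>K. norm x \<le> r))"

lemma R: "0 < R" "x \<in> K \<Longrightarrow> norm x \<le> R"
proof -
  have "\<exists>r. 0 < r \<and> (\<forall>x\<in>K. norm x \<le> r)"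
    using compact_imp_bounded[OF K(1)] by (simp add: bounded_pos)
  from someI_ex[OF this] show "0 < R" "x \<in> K \<Longrightarrow> norm x \<le> R" unfolding R_def by auto
qed

lemma closed_K: "closed K" using K by (simp add: compact_imp_closed)

lemma K_borel [measurable]: "K \<in> sets borel" using closed_K by (rule borel_closed)

lemma sect_measurable:
  assumes "T \<in> sets borel"
  shows "sect T y \<in> sets (leb C)"
proof -
  have "(\<lambda>w. y + lin_comb C w) \<in> measurable (leb C) borel"
    using measurable_compose[OF measurable_lin_comb[OF fin(1)], of "\<lambda>v. y + v" borel]
    by (simp add: borel_measurable_continuous_onI continuous_intros)
  from sets_Collect_preimage[OF this K_borel]
  have "{w \<in> space (leb C). y + lin_comb C w \<in> K} \<in> sets (leb C)" .
  moreover have "(\<lambda>w. w \<eta>) \<in> measurable (leb C) borel"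
    using measurable_component_singleton[OF \<eta>, of "\<lambda>_. lborel"] by simp
  from sets_Collect_preimage[OF this assms]
  have "{w \<in> space (leb C). w \<eta> \<in> T} \<in> sets (leb C)" .
  ultimately have "{w \<in> space (leb C). y + lin_comb C w \<in> K} \<inter> {w \<in> space (leb C). w \<eta> \<in> T} \<in> sets (leb C)"
    by (rule sets.Int)
  moreover have "sect T y = {w \<in> space (leb C). y + lin_comb C w \<in> K} \<inter> {w \<in> space (leb C). w \<eta> \<in> T}"
    by (auto simp: sect_def)
  ultimately show ?thesis by simp
qed

lemma sect_box:
  assumes "norm y \<le> r"
  shows "sect T y \<subseteq> (\<Pi>\<^sub>E b\<in>C. {-(R + r)..R + r})"
proof
  fix w assume w: "w \<in> sect T y"
  have "w b \<in> {-(R + r)..R + r}" if b: "b \<in> C" for b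
  proof -
    have nb: "norm b = 1" using onC b by (simp add: orthonormal_def)
    have "w b = (y + lin_comb C w) \<bullet> b - y \<bullet> b" using fin onC b by (simp add: inner_add_left lin_comb_inner)
    moreover have "\<bar>(y + lin_comb C w) \<bullet> b\<bar> \<le> R"
      using Cauchy_Schwarz_ineq2[of "y + lin_comb C w" b] R(2)[of "y + lin_comb C w"] w nb by (simp add: sect_def)
    moreover have "\<bar>y \<bullet> b\<bar> \<le> r" using Cauchy_Schwarz_ineq2[of y b] nb assms by simp
    ultimately show ?thesis by auto
  qed
  then show "w \<in> (\<Pi>\<^sub>E b\<in>C. {-(R + r)..R + r})" using w by (simp add: sect_def space_PiM PiE_iff)
qed

lemma emeasure_sect_le:
  assumes "norm y \<le> r"
  shows "emeasure (leb C) (sect T y) \<le> ennreal ((2 * (R + r)) ^ m)"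
proof -
  have "0 \<le> R + r" using R(1) norm_ge_zero[of y] assms by linarith
  then show ?thesis
    using emeasure_mono[OF sect_box[OF assms, of T], of "leb C"] emeasure_leb_box[OF fin(1), of "R + r"] fin
    by (simp add: sets_PiM_I_finite)
qed

lemma emeasure_sect: "emeasure (leb C) (sect T y) = ennreal (measure (leb C) (sect T y))"
  using emeasure_sect_le[of y "norm y" T] by (intro emeasure_eq_ennreal_measure) (auto simp: top_unique)

lemma vrad_nonneg: "0 \<le> vrad T y" unfolding vrad_def by (intro real_root_ge_zero measure_nonneg)

lemma vrad_power: "vrad T y ^ m = measure (leb C) (sect T y)"
  using m_pos by (simp add: vrad_def)

lemma vrad_le:
  assumes "norm y \<le> r"
  shows "vrad T y \<le> 2 * (R + r)"
proof -
  have r: "0 \<le> R + r" using R(1) norm_ge_zero[of y] assms by linarith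
  have "vrad T y ^ m \<le> (2 * (R + r)) ^ m"
    using emeasure_sect_le[OF assms, of T] r unfolding emeasure_sect vrad_power by simp
  then show ?thesis using m_pos r by (meson mult_nonneg_nonneg power_mono_iff vrad_nonneg zero_le_numeral)
qed

text \<open>This is where the Brunn--Minkowski inequality enters.\<close>
lemma vrad_concave:
  assumes T: "T \<in> sets borel" "convex T" and ne: "sect T x \<noteq> {}" "sect T y \<noteq> {}" and p: "0 < p" "0 < q" "p + q = 1"
  shows "p * vrad T x + q * vrad T y \<le> vrad T (p *\<^sub>R x + q *\<^sub>R y)"
proof -
  define r where "r = max (max (norm x) (norm y)) (norm (p *\<^sub>R x + q *\<^sub>R y))"
  show ?thesis unfolding vrad_def
  proof (rule brunn_minkowski[where R = "R + r"])
    fix w z assume w: "w \<in> sect T x" and z: "z \<in> sect T y"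
    let ?v = "\<lambda>i\<in>C. p * w i + q * z i"
    have "p *\<^sub>R (x + lin_comb C w) + q *\<^sub>R (y + lin_comb C z) \<in> K"
      using w z p by (intro convexD[OF K(2)]) (auto simp: sect_def)
    moreover have "p *\<^sub>R x + q *\<^sub>R y + lin_comb C ?v = p *\<^sub>R (x + lin_comb C w) + q *\<^sub>R (y + lin_comb C z)"
      by (simp add: lin_comb_add lin_comb_scale algebra_simps)
    moreover have "p * w \<eta> + q * z \<eta> \<in> T" using convexD[OF T(2), of "w \<eta>" "z \<eta>" p q] w z p by (simp add: sect_def)
    ultimately show "?v \<in> sect T (p *\<^sub>R x + q *\<^sub>R y)" using \<eta> by (simp add: sect_def space_PiM)
  next
    show "sect T x \<subseteq> (\<Pi>\<^sub>E i\<in>C. {-(R + r)..R + r})" by (rule sect_box) (simp add: r_def)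
    show "sect T y \<subseteq> (\<Pi>\<^sub>E i\<in>C. {-(R + r)..R + r})" by (rule sect_box) (simp add: r_def)
    show "sect T (p *\<^sub>R x + q *\<^sub>R y) \<subseteq> (\<Pi>\<^sub>E i\<in>C. {-(R + r)..R + r})" by (rule sect_box) (simp add: r_def)
  qed (use fin \<eta> ne p sect_measurable[OF T(1)] in auto)
qed

lemma sect_nonempty:
  assumes "x \<in> K" "0 \<in> T"
  shows "sect T x \<noteq> {}"
proof -
  have "(\<lambda>b\<in>C. 0) \<in> sect T x" using assms \<eta> by (simp add: sect_def space_PiM) (simp add: lin_comb_def)
  then show ?thesis by auto
qed

definition hypograph :: "('a \<times> real) set" where
  "hypograph = {(x, s). x \<in> K \<and> 0 \<le> s \<and> s \<le> vrad {0..} x}"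

text \<open>
  Closedness is upper semicontinuity of the half section volume: since \<open>K\<close> is closed, a point
  outside the half section at the limit is outside the nearby half sections, so the reverse Fatou
  lemma applies.
\<close>
lemma closed_hypograph: "closed hypograph"
  unfolding closed_sequential_limits
proof (intro allI impI)
  fix z :: "nat \<Rightarrow> 'a \<times> real" and l assume "(\<forall>n. z n \<in> hypograph) \<and> z \<longlonglongrightarrow> l"
  then have z: "\<And>n. z n \<in> hypograph" and lim: "z \<longlonglongrightarrow> l" by auto
  define x where "x n = fst (z n)" for n
  define s where "s n = snd (z n)" for n
  have x: "x \<longlonglongrightarrow> fst l" unfolding x_def using lim by (rule tendsto_fst)
  have s: "s \<longlonglongrightarrow> snd l" unfolding s_def using lim by (rule tendsto_snd)
  have xK: "x n \<in> K" and s0: "0 \<le> s n" and sle: "s n \<le> vrad {0..} (x n)" for n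
    using z[of n] by (auto simp: hypograph_def x_def s_def split_beta)
  have lK: "fst l \<in> K" using closed_sequentially[OF closed_K xK x] .
  have l0: "0 \<le> snd l" using LIMSEQ_le_const[OF s, of 0] s0 by auto
  let ?S = "\<lambda>y. sect {0..} y"
  have mS: "?S y \<in> sets (leb C)" for y by (rule sect_measurable) simp
  have "(\<lambda>n. ennreal (s n ^ m)) \<longlonglongrightarrow> ennreal (snd l ^ m)"
    by (intro tendsto_ennrealI tendsto_power s)
  then have "ennreal (snd l ^ m) = limsup (\<lambda>n. ennreal (s n ^ m))"
    by (intro lim_imp_Limsup[symmetric]) auto
  also have "\<dots> \<le> limsup (\<lambda>n. \<integral>\<^sup>+w. indicator (?S (x n)) w \<partial>leb C)"
  proof (rule Limsup_mono, rule always_eventually, rule allI)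
    fix n
    have "s n ^ m \<le> vrad {0..} (x n) ^ m" using sle s0 by (rule power_mono)
    then show "ennreal (s n ^ m) \<le> (\<integral>\<^sup>+w. indicator (?S (x n)) w \<partial>leb C)"
      using mS by (simp add: emeasure_sect vrad_power)
  qed
  also have "\<dots> \<le> (\<integral>\<^sup>+w. limsup (\<lambda>n. indicator (?S (x n)) w) \<partial>leb C)"
  proof (rule nn_integral_limsup[where w = "indicator (\<Pi>\<^sub>E b\<in>C. {-(R + R)..R + R})"])
    have "indicator (?S (x n)) w \<le> (indicator (\<Pi>\<^sub>E b\<in>C. {-(R + R)..R + R}) w :: ennreal)" for n w
      using sect_box[OF R(2)[OF xK[of n]], of "{0..}"] by (auto simp: indicator_def)
    then show "AE w in leb C. indicator (?S (x n)) w \<le> (indicator (\<Pi>\<^sub>E b\<in>C. {-(R + R)..R + R}) w :: ennreal)" for n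
      by simp
    show "(\<integral>\<^sup>+w. indicator (\<Pi>\<^sub>E b\<in>C. {-(R + R)..R + R}) w \<partial>leb C) < \<infinity>"
      using emeasure_leb_box[OF fin(1), of "R + R"] R(1) fin by (simp add: sets_PiM_I_finite)
  qed (use mS fin in \<open>auto intro!: sets_PiM_I_finite\<close>)
  also have "\<dots> \<le> (\<integral>\<^sup>+w. indicator (?S (fst l)) w \<partial>leb C)"
  proof (rule nn_integral_mono)
    fix w assume w: "w \<in> space (leb C)"
    show "limsup (\<lambda>n. indicator (?S (x n)) w) \<le> (indicator (?S (fst l)) w :: ennreal)"
    proof (cases "w \<in> ?S (fst l)")
      case True
      then show ?thesis by (intro Limsup_bounded always_eventually) (auto simp: indicator_def)
    next
      case False
      have "eventually (\<lambda>n. w \<notin> ?S (x n)) sequentially"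
      proof (cases "0 \<le> w \<eta>")
        case True
        then have "fst l + lin_comb C w \<in> - K" using False w by (auto simp: sect_def)
        moreover have "(\<lambda>n. x n + lin_comb C w) \<longlonglongrightarrow> fst l + lin_comb C w" by (intro tendsto_intros x)
        ultimately have "eventually (\<lambda>n. x n + lin_comb C w \<in> - K) sequentially"
          using closed_K by (intro topological_tendstoD) (auto simp: open_Compl)
        then show ?thesis by eventually_elim (auto simp: sect_def)
      qed (simp add: sect_def)
      then have "eventually (\<lambda>n. indicator (?S (x n)) w \<le> (indicator (?S (fst l)) w :: ennreal)) sequentially"
        by eventually_elim (simp add: indicator_def)
      then show ?thesis by (rule Limsup_bounded)
    qed
  qed
  also have "\<dots> = ennreal (vrad {0..} (fst l) ^ m)" using mS by (simp add: emeasure_sect vrad_power)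
  finally have "snd l ^ m \<le> vrad {0..} (fst l) ^ m" using vrad_nonneg by simp
  then have "snd l \<le> vrad {0..} (fst l)" using m_pos l0 vrad_nonneg power_mono_iff by blast
  then show "l \<in> hypograph" using lK l0 by (simp add: hypograph_def split_beta)
qed

lemma compact_hypograph: "compact hypograph"
proof -
  have "compact (K \<times> {0..2 * (R + R)})" by (intro compact_Times K compact_Icc)
  then have "compact ((K \<times> {0..2 * (R + R)}) \<inter> hypograph)"
    using closed_hypograph by (rule compact_Int_closed)
  moreover have "b \<le> 2 * (R + R)" if "(a, b) \<in> hypograph" for a b
    using that vrad_le[OF R(2)[of a], of "{0..}"] by (auto simp: hypograph_def)
  then have "(K \<times> {0..2 * (R + R)}) \<inter> hypograph = hypograph"
    by (auto simp: hypograph_def)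
  ultimately show ?thesis by simp
qed

lemma convex_hypograph: "convex hypograph"
proof (rule convexI)
  fix a b :: "'a \<times> real" and p q :: real
  assume a: "a \<in> hypograph" and b: "b \<in> hypograph" and p: "0 \<le> p" "0 \<le> q" "p + q = 1"
  show "p *\<^sub>R a + q *\<^sub>R b \<in> hypograph"
  proof (cases "p = 0 \<or> q = 0")
    case True
    then show ?thesis using a b p by auto
  next
    case False
    obtain x s where as: "a = (x, s)" by (cases a)
    obtain y t where bt: "b = (y, t)" by (cases b)
    have 1: "x \<in> K" "y \<in> K" "0 \<le> s" "0 \<le> t" "s \<le> vrad {0..} x" "t \<le> vrad {0..} y"
      using a b by (auto simp: as bt hypograph_def)
    have "p * s + q * t \<le> p * vrad {0..} x + q * vrad {0..} y"
      using 1 p by (intro add_mono mult_left_mono) auto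
    also have "\<dots> \<le> vrad {0..} (p *\<^sub>R x + q *\<^sub>R y)"
      using 1 p False sect_nonempty[of _ "{0..}"] by (intro vrad_concave) auto
    finally show ?thesis using 1 p convexD[OF K(2), of x y p q] by (simp add: as bt hypograph_def)
  qed
qed

definition half_radius :: "'a \<Rightarrow> real" where
  "half_radius x = indicator K x * vrad {0..} x"

lemma half_radius_nonneg: "0 \<le> half_radius x" by (simp add: half_radius_def vrad_nonneg)

lemma half_radius_measurable [measurable]: "half_radius \<in> borel_measurable borel"
proof (rule borel_measurableI_ge)
  fix a :: real
  show "{x \<in> space borel. a \<le> half_radius x} \<in> sets borel"
  proof (cases "a \<le> 0")
    case True
    then have "{x \<in> space borel. a \<le> half_radius x} = UNIV" using vrad_nonneg
      by (auto simp: half_radius_def indicator_def intro: order_trans)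
    then show ?thesis by simp
  next
    case False
    have "{x \<in> space borel. a \<le> half_radius x} = (\<lambda>x. (x, a)) -` hypograph"
      using False by (auto simp: half_radius_def hypograph_def indicator_def)
    moreover have "closed ((\<lambda>x. (x, a)) -` hypograph)"
      by (intro closed_vimage closed_hypograph continuous_intros)
    ultimately show ?thesis by simp
  qed
qed

abbreviation "M \<equiv> lborel_span (C \<union> D)"

lemma emeasure_K_finite: "emeasure M K < \<infinity>"
  using fin on R by (intro emeasure_lborel_span_bounded[where R = R]) auto

lemma measure_K_pos: "0 < measure M K" and emeasure_K: "emeasure M K = ennreal (measure M K)"
  using pos emeasure_K_finite by (simp_all add: emeasure_eq_ennreal_measure less_top)

lemma integrable_on_K:
  assumes "f \<in> borel_measurable borel" "\<And>x. x \<in> K \<Longrightarrow> \<bar>f x\<bar> \<le> B"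
  shows "integrable M (\<lambda>x. indicator K x * f x :: real)"
proof -
  have "integrable M (\<lambda>x. indicator K x *\<^sub>R f x)"
    using assms emeasure_K_finite by (intro integrableI_bounded_set_indicator[where B = B]) auto
  then show ?thesis by simp
qed

lemma integrable_half_radius: "integrable M half_radius"
proof -
  have "integrable M (\<lambda>x. indicator K x * half_radius x)"
  proof (rule integrable_on_K)
    show "\<bar>half_radius x\<bar> \<le> 2 * (R + R)" if "x \<in> K" for x using vrad_le[OF R(2)[OF that], of "{0..}"] vrad_nonneg that by (simp add: half_radius_def)
  qed simp
  moreover have "(\<lambda>x. indicator K x * half_radius x) = half_radius" by (auto simp: half_radius_def indicator_def)
  ultimately show ?thesis by simp
qed

text \<open>
  Jensen's inequality for the concave function \<^term>\<open>vrad {0..}\<close> at the centroid of \<open>K\<close>: the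
  barycentre of its graph lies in the compact convex hypograph.
\<close>
lemma half_radius_zero_ge_mean: "0 \<in> K" "(\<integral>x. half_radius x \<partial>M) \<le> measure M K * vrad {0..} 0"
proof -
  \<comment> \<open>the barycentre of the graph of the half radius\<close>
  let ?c = "(0 :: 'a, (\<integral>x. half_radius x \<partial>M) / measure M K)"
  have "?c \<in> hypograph"
  proof (rule barycenter_in_compact_convex[where M = M and K = K and X = "\<lambda>x. (x, half_radius x)"])
    show "(x, half_radius x) \<in> hypograph" if "x \<in> K" for x using that vrad_nonneg by (simp add: hypograph_def half_radius_def)
    have i1: "integrable M (\<lambda>x. indicator K x * (x \<bullet> a))" for a
    proof (rule integrable_on_K)
      show "(\<lambda>x. x \<bullet> a) \<in> borel_measurable borel" by (intro borel_measurable_continuous_onI continuous_intros)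
      show "\<bar>x \<bullet> a\<bar> \<le> R * norm a" if "x \<in> K" for x
        using Cauchy_Schwarz_ineq2[of x a] mult_right_mono[OF R(2)[OF that], of "norm a"] by simp
    qed
    have i2: "integrable M (\<lambda>x. half_radius x * b)" for b using integrable_half_radius by simp
    have e: "indicator K x * ((x, half_radius x) \<bullet> z) = indicator K x * (x \<bullet> fst z) + half_radius x * snd z" for x z
      by (cases z) (auto simp: half_radius_def indicator_def)
    show "integrable M (\<lambda>x. indicator K x * ((x, half_radius x) \<bullet> z))" for z
      unfolding e using i1[of "fst z"] i2[of "snd z"] by (rule Bochner_Integration.integrable_add)
    show "(\<integral>x. indicator K x * ((x, half_radius x) \<bullet> z) \<partial>M) = measure M K * (?c \<bullet> z)" for z
      unfolding e using measure_K_pos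
      by (subst Bochner_Integration.integral_add[OF i1[of "fst z"] i2[of "snd z"]]) (cases z, simp add: cent)
  qed (use compact_hypograph convex_hypograph pos emeasure_K_finite in auto)
  then show "0 \<in> K" "(\<integral>x. half_radius x \<partial>M) \<le> measure M K * vrad {0..} 0"
    using measure_K_pos by (auto simp: hypograph_def pos_divide_le_eq mult.commute)
qed


lemma lin_comb_merge: "lin_comb (C \<union> D) (merge D C (y, w)) = lin_comb D y + lin_comb C w"
proof -
  have "lin_comb (C \<union> D) (merge D C (y, w)) = lin_comb D (merge D C (y, w)) + lin_comb C (merge D C (y, w))"
    unfolding lin_comb_def using fin disj by (simp add: sum.union_disjoint add.commute)
  also have "lin_comb D (merge D C (y, w)) = lin_comb D y" by (auto simp: lin_comb_def merge_def intro!: sum.cong)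
  also have "lin_comb C (merge D C (y, w)) = lin_comb C w"
    using disj by (auto simp: lin_comb_def merge_def intro!: sum.cong)
  finally show ?thesis .
qed

lemma measurable_sum_pair:
  "(\<lambda>p. lin_comb D (fst p) + lin_comb C (snd p)) \<in> measurable (leb D \<Otimes>\<^sub>M leb C) borel"
proof -
  have "lin_comb (C \<union> D) \<in> measurable (leb (D \<union> C)) borel" using fin by (subst Un_commute) (rule measurable_lin_comb, simp)
  from measurable_compose[OF measurable_merge this]
  have "(\<lambda>p. lin_comb (C \<union> D) (merge D C p)) \<in> measurable (leb D \<Otimes>\<^sub>M leb C) borel" .
  moreover have "lin_comb (C \<union> D) (merge D C p) = lin_comb D (fst p) + lin_comb C (snd p)" for p
    using lin_comb_merge[of "fst p" "snd p"] by simp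
  ultimately show ?thesis by simp
qed

lemma nn_integral_slices:
  assumes "f \<in> borel_measurable borel"
  shows "(\<integral>\<^sup>+x. f x \<partial>M) = (\<integral>\<^sup>+y. (\<integral>\<^sup>+w. f (lin_comb D y + lin_comb C w) \<partial>leb C) \<partial>leb D)"
proof -
  interpret L: product_sigma_finite "\<lambda>_. lborel :: real measure" by (rule product_sigma_finite_lborel)
  have "(\<integral>\<^sup>+x. f x \<partial>M) = (\<integral>\<^sup>+w. f (lin_comb (C \<union> D) w) \<partial>leb (D \<union> C))"
    using fin assms by (subst nn_integral_lborel_span) (auto simp: Un_commute)
  also have "\<dots> = (\<integral>\<^sup>+y. (\<integral>\<^sup>+w. f (lin_comb (C \<union> D) (merge D C (y, w))) \<partial>leb C) \<partial>leb D)"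
    using fin disj measurable_compose[OF measurable_lin_comb[of "C \<union> D"] assms]
    by (intro L.product_nn_integral_fold) (auto simp: Un_commute)
  finally show ?thesis by (simp add: lin_comb_merge)
qed

lemma measurable_vrad: "(\<lambda>y. vrad UNIV (lin_comb D y)) \<in> borel_measurable (leb D)"
proof -
  interpret sigma_finite_measure "leb C" by (rule sigma_finite_leb) (rule fin)
  have "{p \<in> space (leb D \<Otimes>\<^sub>M leb C). lin_comb D (fst p) + lin_comb C (snd p) \<in> K} \<in> sets (leb D \<Otimes>\<^sub>M leb C)"
    by (rule sets_Collect_preimage[OF measurable_sum_pair K_borel])
  from measurable_emeasure_Pair[OF this]
  have 1: "(\<lambda>y. emeasure (leb C) (Pair y -` {p \<in> space (leb D \<Otimes>\<^sub>M leb C). lin_comb D (fst p) + lin_comb C (snd p) \<in> K}))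
    \<in> borel_measurable (leb D)" .
  have "(\<lambda>y. emeasure (leb C) (sect UNIV (lin_comb D y))) \<in> borel_measurable (leb D)"
    by (rule measurable_cong[THEN iffD1, OF _ 1])
      (auto simp: sect_def space_pair_measure intro!: arg_cong[where f = "emeasure (leb C)"])
  then show ?thesis unfolding vrad_def measure_def by measurable
qed

lemma measure_K_slices: "ennreal (measure M K) = (\<integral>\<^sup>+y. ennreal (vrad UNIV (lin_comb D y) ^ m) \<partial>leb D)"
proof -
  have "ennreal (measure M K) = (\<integral>\<^sup>+x. indicator K x \<partial>M)" by (simp add: emeasure_K)
  also have "\<dots> = (\<integral>\<^sup>+y. (\<integral>\<^sup>+w. indicator K (lin_comb D y + lin_comb C w) \<partial>leb C) \<partial>leb D)"
    by (rule nn_integral_slices) simp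
  also have "\<dots> = (\<integral>\<^sup>+y. ennreal (vrad UNIV (lin_comb D y) ^ m) \<partial>leb D)"
  proof (rule nn_integral_cong)
    fix y
    have "(\<integral>\<^sup>+w. indicator K (lin_comb D y + lin_comb C w) \<partial>leb C)
       = (\<integral>\<^sup>+w. indicator (sect UNIV (lin_comb D y)) w \<partial>leb C)"
      by (intro nn_integral_cong) (auto simp: sect_def indicator_def)
    then show "(\<integral>\<^sup>+w. indicator K (lin_comb D y + lin_comb C w) \<partial>leb C) = ennreal (vrad UNIV (lin_comb D y) ^ m)"
      using sect_measurable[of UNIV] by (simp add: emeasure_sect vrad_power)
  qed
  finally show ?thesis .
qed

text \<open>
  The half section at a point of a slice is an upper tail of that slice for the \<open>\<eta>\<close>-coordinate.
\<close>
lemma measure_sect_shift: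
  assumes "w \<in> space (leb C)"
  shows "measure (leb C) (sect {0..} (y + lin_comb C w)) = measure (leb C) {g \<in> sect UNIV y. w \<eta> \<le> g \<eta>}"
proof -
  have A: "{g \<in> sect UNIV y. w \<eta> \<le> g \<eta>} = sect {w \<eta>..} y" by (auto simp: sect_def)
  have "emeasure (leb C) (sect {w \<eta>..} y)
      = emeasure (leb C) {g \<in> space (leb C). (\<lambda>j\<in>C. w j + 1 * g j) \<in> sect {w \<eta>..} y}"
    using emeasure_leb_affine[OF fin(1), of "\<lambda>j. j" C 1 "sect {w \<eta>..} y" w] sect_measurable[of "{w \<eta>..}" y]
    by (simp add: bij_betw_def)
  also have "{g \<in> space (leb C). (\<lambda>j\<in>C. w j + 1 * g j) \<in> sect {w \<eta>..} y} = sect {0..} (y + lin_comb C w)"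
    using \<eta> by (auto simp: sect_def space_PiM lin_comb_add add.assoc)
  finally show ?thesis unfolding A measure_def by simp
qed

lemma integral_half_radius_lower:
  "ennreal (real m / (real m + 1)) * (\<integral>\<^sup>+y. ennreal (vrad UNIV (lin_comb D y) ^ (m + 1)) \<partial>leb D)
    \<le> ennreal (\<integral>x. half_radius x \<partial>M)"
proof -
  have vm: "(\<lambda>y. ennreal (vrad UNIV (lin_comb D y) ^ (m + 1))) \<in> borel_measurable (leb D)"
    using measurable_vrad by measurable
  have "ennreal (real m / (real m + 1)) * (\<integral>\<^sup>+y. ennreal (vrad UNIV (lin_comb D y) ^ (m + 1)) \<partial>leb D)
      = (\<integral>\<^sup>+y. ennreal (real m / (real m + 1) * vrad UNIV (lin_comb D y) ^ (m + 1)) \<partial>leb D)"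
    unfolding nn_integral_cmult[OF vm, symmetric] using vrad_nonneg by (simp add: ennreal_mult'[symmetric])
  also have "\<dots> \<le> (\<integral>\<^sup>+y. (\<integral>\<^sup>+w. ennreal (half_radius (lin_comb D y + lin_comb C w)) \<partial>leb C) \<partial>leb D)"
  proof (rule nn_integral_mono)
    fix y
    let ?S = "sect UNIV (lin_comb D y)"
    have "ennreal (real m / (real m + 1) * vrad UNIV (lin_comb D y) ^ (m + 1))
        \<le> (\<integral>\<^sup>+w. indicator ?S w * ennreal (root m (measure (leb C) {g \<in> ?S. w \<eta> \<le> g \<eta>})) \<partial>leb C)"
      unfolding vrad_def
    proof (rule nn_integral_upper_tail[OF sigma_finite_leb[OF fin(1)] sect_measurable _ _ m_pos])
      show "emeasure (leb C) ?S < \<infinity>" by (simp add: emeasure_sect)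
      show "(\<lambda>w. w \<eta>) \<in> borel_measurable (leb C)"
        using measurable_component_singleton[OF \<eta>, of "\<lambda>_. lborel"] by simp
    qed simp
    also have "\<dots> = (\<integral>\<^sup>+w. ennreal (half_radius (lin_comb D y + lin_comb C w)) \<partial>leb C)"
    proof (rule nn_integral_cong)
      fix w assume w: "w \<in> space (leb C)"
      then show "indicator ?S w * ennreal (root m (measure (leb C) {g \<in> ?S. w \<eta> \<le> g \<eta>})) = ennreal (half_radius (lin_comb D y + lin_comb C w))"
        unfolding measure_sect_shift[OF w, symmetric] by (auto simp: half_radius_def vrad_def sect_def indicator_def)
    qed
    finally show "ennreal (real m / (real m + 1) * vrad UNIV (lin_comb D y) ^ (m + 1)) \<le> \<dots>" .
  qed
  also have "\<dots> = (\<integral>\<^sup>+x. ennreal (half_radius x) \<partial>M)" by (rule nn_integral_slices[symmetric]) simp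
  also have "\<dots> = ennreal (\<integral>x. half_radius x \<partial>M)"
    using integrable_half_radius half_radius_nonneg by (intro nn_integral_eq_integral) auto
  finally show ?thesis .
qed

text \<open>
  Let \<open>\<psi>\<close> be the volume radius of the slices and \<open>X\<close> the integral of \<open>\<psi> ^ (m + 1)\<close>. Shrinking the
  parameter \<open>y\<close> towards \<open>0\<close> by a factor \<open>l < 1\<close> scales \<open>X\<close> by \<open>l ^ d\<close>, while concavity gives
  \<open>\<psi> (l * y) \<ge> l * \<psi> y + (1 - l) * \<psi> 0\<close> wherever the slice is nonempty. Comparing the terms of first
  order in \<open>1 - l\<close> as \<open>l\<close> tends to \<open>1\<close> yields the inequality. This takes the place of an
  integration by parts.
\<close>
lemma vrad_power_integral_lower:
  obtains X where "0 \<le> X" "(\<integral>\<^sup>+y. ennreal (vrad UNIV (lin_comb D y) ^ (m + 1)) \<partial>leb D) = ennreal X"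
    "(real m + 1) * (vrad UNIV 0 * measure M K) \<le> (real (d + m) + 1) * X"
proof -
  define \<psi> where "\<psi> y = vrad UNIV (lin_comb D y)" for y
  have \<psi>m [measurable]: "\<psi> \<in> borel_measurable (leb D)" unfolding \<psi>_def by (rule measurable_vrad)
  have \<psi>0: "0 \<le> \<psi> y" for y by (simp add: \<psi>_def vrad_nonneg)
  define X where "X = enn2real (\<integral>\<^sup>+y. ennreal (\<psi> y ^ (m + 1)) \<partial>leb D)"
  have "(\<integral>\<^sup>+y. ennreal (\<psi> y ^ (m + 1)) \<partial>leb D) \<noteq> top"
  proof
    assume "(\<integral>\<^sup>+y. ennreal (\<psi> y ^ (m + 1)) \<partial>leb D) = top"
    with integral_half_radius_lower show False using m_pos by (simp add: \<psi>_def ennreal_mult_top top_unique)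
  qed
  then have X: "(\<integral>\<^sup>+y. ennreal (\<psi> y ^ (m + 1)) \<partial>leb D) = ennreal X"
    by (simp add: X_def less_top)
  have X0: "0 \<le> X" by (simp add: X_def)
  define J where "J = vrad UNIV 0"
  have J0: "0 \<le> J" by (simp add: J_def vrad_nonneg)
  define k where "k = measure M K"
  have k: "ennreal k = (\<integral>\<^sup>+y. ennreal (\<psi> y ^ m) \<partial>leb D)" by (simp add: k_def \<psi>_def measure_K_slices)
  have k0: "0 < k" by (simp add: k_def measure_K_pos)
  \<comment> \<open>the inequality for a fixed shrinking factor, already divided by \<open>1 - l\<close>\<close>
  have step: "l ^ (d + m) * ((real m + 1) * (J * k)) \<le> (real (d + m) + 1) * X" if l: "0 < l" "l < 1" for l :: real
  proof -
    \<comment> \<open>the terms of order 0 and 1 in \<open>(1 - l) * J\<close> of \<open>(l * \<psi> y + (1 - l) * J) ^ (m + 1)\<close>\<close>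
    have pw: "l ^ (m + 1) * \<psi> y ^ (m + 1) + (real m + 1) * l ^ m * (1 - l) * J * \<psi> y ^ m \<le> \<psi> (\<lambda>j\<in>D. 0 + l * y j) ^ (m + 1)" for y
    proof (cases "\<psi> y = 0")
      case True
      then show ?thesis using m_pos \<psi>0 by (simp add: zero_power)
    next
      case False
      then have "sect UNIV (lin_comb D y) \<noteq> {}" using m_pos by (auto simp: \<psi>_def vrad_def)
      moreover have "sect UNIV 0 \<noteq> {}" using half_radius_zero_ge_mean(1) by (intro sect_nonempty) auto
      ultimately have "(1 - l) * J + l * \<psi> y \<le> vrad UNIV ((1 - l) *\<^sub>R 0 + l *\<^sub>R lin_comb D y)"
        unfolding J_def \<psi>_def using l by (intro vrad_concave) auto
      also have "(1 - l) *\<^sub>R 0 + l *\<^sub>R lin_comb D y = lin_comb D (\<lambda>j\<in>D. 0 + l * y j)" by (simp add: lin_comb_scale)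
      finally have le: "l * \<psi> y + (1 - l) * J \<le> \<psi> (\<lambda>j\<in>D. 0 + l * y j)" by (simp add: \<psi>_def add.commute)
      have lp: "0 < l * \<psi> y" using l False \<psi>0[of y] by simp
      have "l ^ (m + 1) * \<psi> y ^ (m + 1) + (real m + 1) * l ^ m * (1 - l) * J * \<psi> y ^ m
          = (l * \<psi> y) ^ (m + 1) * (1 + real (m + 1) * ((1 - l) * J / (l * \<psi> y)))"
      proof -
        have expand: "a ^ (m + 1) * (1 + c * (b / a)) = a ^ (m + 1) + c * b * a ^ m" if "a \<noteq> 0" for a b c :: real
          using that by (simp add: field_simps)
        show ?thesis unfolding expand[OF less_imp_neq[OF lp, symmetric]]
          by (simp add: power_mult_distrib mult_ac)
      qed
      also have "\<dots> \<le> (l * \<psi> y) ^ (m + 1) * (1 + (1 - l) * J / (l * \<psi> y)) ^ (m + 1)"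
      proof (rule mult_left_mono[OF Bernoulli_inequality])
        have "0 \<le> (1 - l) * J / (l * \<psi> y)" using l J0 lp by simp
        then show "-1 \<le> (1 - l) * J / (l * \<psi> y)" by linarith
      qed (use lp in simp)
      also have "\<dots> = (l * \<psi> y + (1 - l) * J) ^ (m + 1)"
      proof -
        have expand: "a * (1 + b / a) = a + b" if "a \<noteq> 0" for a b :: real
          using that by (simp add: field_simps)
        show ?thesis unfolding power_mult_distrib[symmetric] expand[OF less_imp_neq[OF lp, symmetric]] ..
      qed
      also have "\<dots> \<le> \<psi> (\<lambda>j\<in>D. 0 + l * y j) ^ (m + 1)"
        using le lp l J0 by (intro power_mono) auto
      finally show ?thesis .
    qed
    have "ennreal (l ^ d * (l ^ (m + 1) * X + (real m + 1) * l ^ m * (1 - l) * J * k))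
        = ennreal (l ^ d) * (ennreal (l ^ (m + 1)) * ennreal X + ennreal ((real m + 1) * l ^ m * (1 - l) * J) * ennreal k)"
      using l X0 J0 k0 by (simp add: ennreal_mult'[symmetric] ennreal_plus[symmetric] del: ennreal_plus)
    also have "\<dots> = ennreal (l ^ d) * (\<integral>\<^sup>+y. ennreal (l ^ (m + 1) * \<psi> y ^ (m + 1) + (real m + 1) * l ^ m * (1 - l) * J * \<psi> y ^ m) \<partial>leb D)"
      unfolding X[symmetric] k using l J0 \<psi>0
      by (simp add: nn_integral_cmult[symmetric] nn_integral_add[symmetric] ennreal_mult'[symmetric] ennreal_plus[symmetric] del: ennreal_plus power_Suc)
    also have "\<dots> \<le> ennreal (l ^ d) * (\<integral>\<^sup>+y. ennreal (\<psi> (\<lambda>j\<in>D. 0 + l * y j) ^ (m + 1)) \<partial>leb D)"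
      by (intro mult_left_mono nn_integral_mono ennreal_leI pw) auto
    also have "\<dots> = (\<integral>\<^sup>+y. ennreal (\<psi> y ^ (m + 1)) \<partial>leb D)"
      using nn_integral_leb_affine[OF fin(2), of "\<lambda>j. j" D l "\<lambda>y. ennreal (\<psi> y ^ (m + 1))" "\<lambda>_. 0"] l
      by (simp add: bij_betw_def ennreal_power)
    also have "\<dots> = ennreal X" by (rule X)
    finally have "l ^ d * (l ^ (m + 1) * X + (real m + 1) * l ^ m * (1 - l) * J * k) \<le> X"
      using X0 by simp
    then have "l ^ (d + m) * (real m + 1) * (1 - l) * J * k \<le> (1 - l ^ (d + m + 1)) * X"
      by (simp add: algebra_simps power_add)
    also have "\<dots> \<le> ((real (d + m) + 1) * (1 - l)) * X"
    proof (rule mult_right_mono[OF _ X0])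
      show "1 - l ^ (d + m + 1) \<le> (real (d + m) + 1) * (1 - l)"
        using Bernoulli_inequality[of "l - 1" "d + m + 1"] l by (simp add: algebra_simps)
    qed
    finally have "(1 - l) * (l ^ (d + m) * ((real m + 1) * (J * k))) \<le> (1 - l) * ((real (d + m) + 1) * X)"
      by (simp add: mult_ac)
    then show ?thesis using l by simp
  qed
  have "((\<lambda>l. l ^ (d + m) * ((real m + 1) * (J * k))) \<longlongrightarrow> 1 ^ (d + m) * ((real m + 1) * (J * k))) (at_left (1::real))"
    by (intro tendsto_intros)
  moreover have "eventually (\<lambda>l. l ^ (d + m) * ((real m + 1) * (J * k)) \<le> (real (d + m) + 1) * X) (at_left (1::real))"
    unfolding eventually_at_left_field by (intro exI[of _ 0]) (use step in auto)
  ultimately have "1 ^ (d + m) * ((real m + 1) * (J * k)) \<le> (real (d + m) + 1) * X"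
    by (rule tendsto_upperbound) simp
  then show ?thesis using that[of X] X X0 by (simp add: \<psi>_def J_def k_def)
qed

text \<open>
  Let \<open>X\<close> be the integral of the power \<open>m + 1\<close> of the slice radius. The half section radius at the
  centroid is at least its mean over \<open>K\<close>; its integral over \<open>K\<close> is at least \<open>m / (m + 1) * X\<close>; and
  \<open>X\<close> is at least \<open>(m + 1) / (d + m + 1)\<close> times the volume of \<open>K\<close> times the radius of the central
  slice. The factors \<open>m + 1\<close> cancel.
\<close>
theorem half_section_lower_bound:
  "(real m / (real (d + m) + 1)) ^ m * measure (leb C) (sect UNIV 0) \<le> measure (leb C) (sect {0..} 0)"
proof -
  obtain X where X: "0 \<le> X" "(\<integral>\<^sup>+y. ennreal (vrad UNIV (lin_comb D y) ^ (m + 1)) \<partial>leb D) = ennreal X"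
    "(real m + 1) * (vrad UNIV 0 * measure M K) \<le> (real (d + m) + 1) * X" by (rule vrad_power_integral_lower)
  have v0: "0 \<le> (\<integral>x. half_radius x \<partial>M)" by (intro Bochner_Integration.integral_nonneg half_radius_nonneg)
  have "ennreal (real m / (real m + 1) * X) \<le> ennreal (\<integral>x. half_radius x \<partial>M)"
    using integral_half_radius_lower unfolding X(2) by (simp add: ennreal_mult'[symmetric])
  then have "real m / (real m + 1) * X \<le> (\<integral>x. half_radius x \<partial>M)" using v0 by simp
  also note half_radius_zero_ge_mean(2)
  finally have 1: "real m * X \<le> (real m + 1) * (measure M K * vrad {0..} 0)" by (simp add: field_simps)
  have "(real m + 1) * (real m * (vrad UNIV 0 * measure M K)) \<le> (real (d + m) + 1) * (real m * X)"
    using mult_left_mono[OF X(3), of "real m"] by (simp add: mult_ac)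
  also have "\<dots> \<le> (real (d + m) + 1) * ((real m + 1) * (measure M K * vrad {0..} 0))"
    using 1 by (intro mult_left_mono) auto
  finally have "((real m + 1) * measure M K) * (real m * vrad UNIV 0) \<le> ((real m + 1) * measure M K) * ((real (d + m) + 1) * vrad {0..} 0)"
    by (simp add: mult_ac)
  then have "real m * vrad UNIV 0 \<le> (real (d + m) + 1) * vrad {0..} 0"
    using measure_K_pos by (simp add: mult_le_cancel_left_pos)
  then have "real m / (real (d + m) + 1) * vrad UNIV 0 \<le> vrad {0..} 0"
    by (simp add: field_simps)
  then have "(real m / (real (d + m) + 1) * vrad UNIV 0) ^ m \<le> vrad {0..} 0 ^ m"
    using vrad_nonneg by (intro power_mono) auto
  then show ?thesis unfolding power_mult_distrib vrad_power .
qed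

end

section \<open>Adapted orthonormal bases\<close>

lemma orthonormal_basis_exists:
  fixes V :: "'a::real_inner set"
  assumes V: "subspace V" and W: "finite W" "V \<subseteq> span W"
  obtains B where "finite B" "orthonormal B" "span B = V" "card B = dim V"
proof -
  obtain S where S: "S \<subseteq> V" "independent S" "V \<subseteq> span S"
    using maximal_independent_subset[of V] by auto
  have "finite S" using independent_span_bound[OF W(1) S(2)] S(1) W(2) by auto
  have spS: "span S = V" using S V by (meson span_minimal subset_antisym)
  obtain G where G: "finite G" "span G = span S" "pairwise orthogonal G"
    using basis_orthogonal[OF \<open>finite S\<close>] by auto
  define B where "B = (\<lambda>g. g /\<^sub>R norm g) ` (G - {0})"
  have fB: "finite B" using G by (simp add: B_def)
  have oB: "orthonormal B"
    unfolding orthonormal_def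
  proof
    show "pairwise orthogonal B"
      using G(3) by (auto simp: B_def pairwise_def orthogonal_def)
  qed (auto simp: B_def)
  have "span B = V"
  proof
    have "B \<subseteq> span G" by (auto simp: B_def span_base span_scale)
    then show "span B \<subseteq> V" using G(2) spS by (metis span_minimal subspace_span)
    have "g \<in> span B" if "g \<in> G" for g
    proof (cases "g = 0")
      case False
      then have "g /\<^sub>R norm g \<in> span B" using that by (intro span_base) (auto simp: B_def)
      from span_scale[OF this, of "norm g"] False show ?thesis by simp
    qed (simp add: span_zero)
    then have "span G \<subseteq> span B" by (intro span_minimal) auto
    then show "V \<subseteq> span B" using G(2) spS by simp
  qed
  moreover have "card B = dim V"
    using calculation dim_span_eq_card_independent[OF orthonormal_independent[OF oB]] by simp
  ultimately show ?thesis using that fB oB by blast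
qed

lemma orthonormal_extension_exists:
  fixes C :: "'a::real_inner set"
  assumes C: "finite C" "orthonormal C" "C \<subseteq> span W" and W: "finite W"
  obtains D where "finite D" "C \<inter> D = {}" "orthonormal (C \<union> D)" "span (C \<union> D) = span W"
proof -
  define V where "V = span W \<inter> {x. \<forall>c\<in>C. orthogonal c x}"
  have "subspace {x. \<forall>c\<in>C. orthogonal c x}"
    by (auto simp: subspace_def orthogonal_def inner_add_right)
  then have "subspace V" unfolding V_def by (intro subspace_inter) auto
  moreover have "V \<subseteq> span W" by (simp add: V_def)
  ultimately obtain D where D: "finite D" "orthonormal D" "span D = V"
    using orthonormal_basis_exists[OF _ W] by metis
  have DV: "D \<subseteq> V" using D(3) span_superset by auto
  have cd: "c \<bullet> e = 0" if "c \<in> C" "e \<in> D" for c e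
    using that DV by (auto simp: V_def orthogonal_def)
  have disj: "C \<inter> D = {}"
  proof (rule ccontr)
    assume "C \<inter> D \<noteq> {}"
    then obtain c where "c \<in> C" "c \<in> D" by auto
    then show False using cd[of c c] C(2) by (auto simp: orthonormal_def)
  qed
  have dc: "e \<bullet> c = 0" if "c \<in> C" "e \<in> D" for c e
    using cd[OF that] by (simp add: inner_commute)
  have on: "orthonormal (C \<union> D)"
    using C(2) D(2) cd dc by (auto simp: orthonormal_def pairwise_def orthogonal_def)
  \<comment> \<open>a vector differs from its projection to \<open>span C\<close> by an element of \<open>V\<close>\<close>
  have "span (C \<union> D) = span W"
  proof
    show "span (C \<union> D) \<subseteq> span W" using C(3) DV by (intro span_minimal) (auto simp: V_def)
    show "span W \<subseteq> span (C \<union> D)"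
    proof
      fix x assume x: "x \<in> span W"
      let ?p = "lin_comb C (\<lambda>c. x \<bullet> c)"
      have pC: "?p \<in> span C" by (rule lin_comb_in_span)
      moreover have "span C \<subseteq> span W" using C(3) by (intro span_minimal) auto
      ultimately have "x - ?p \<in> span W" using x by (auto intro: span_diff)
      moreover have "orthogonal c (x - ?p)" if "c \<in> C" for c
        using lin_comb_inner[OF C(1,2) that, of "\<lambda>c. x \<bullet> c"] by (simp add: orthogonal_def inner_diff_right inner_commute)
      ultimately have "x - ?p \<in> span D" using D(3) by (simp add: V_def)
      then have "x - ?p \<in> span (C \<union> D)" "?p \<in> span (C \<union> D)" using pC span_mono[of D "C \<union> D"] span_mono[of C "C \<union> D"] by auto
      from span_add[OF this] show "x \<in> span (C \<union> D)" by simp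
    qed
  qed
  then show ?thesis using that D(1) disj on by blast
qed

section \<open>Sections of convex bodies through the centroid\<close>

lemma coord_unit: "coord (unit_fseq j) i = (if i = j then 1 else 0)"
  by transfer simp

lemma inner_unit_fseq: "x \<bullet> unit_fseq i = coord x i"
  using inner_fseq_eq_sum[of "{i}" x "unit_fseq i"] by (auto simp: coord_unit)

lemma inj_unit_fseq: "inj unit_fseq"
proof (rule injI)
  fix i j assume "unit_fseq i = unit_fseq j"
  then have "coord (unit_fseq i) i = coord (unit_fseq j) i" by simp
  then show "i = j" by (simp add: coord_unit split: if_splits)
qed

lemma orthonormal_units: "orthonormal (unit_fseq ` A)"
  by (auto simp: orthonormal_def pairwise_def orthogonal_def inner_unit_fseq coord_unit norm_eq_1)

lemma sum_coord_units:
  assumes "x \<in> Rn n"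
  shows "(\<Sum>i<n. coord x i *\<^sub>R unit_fseq i) = x"
proof (rule fseq_eqI)
  fix j
  have cs: "coord (\<Sum>i\<in>A. f i) j = (\<Sum>i\<in>A. coord (f i) j)" if "finite A" for A :: "nat set" and f
    using that by (induction A rule: finite_induct) auto
  have "coord (\<Sum>i<n. coord x i *\<^sub>R unit_fseq i) j = (\<Sum>i<n. if i = j then coord x i else 0)"
    by (simp add: cs coord_unit eq_commute if_distrib cong: if_cong)
  also have "\<dots> = coord x j" using assms by (auto simp: Rn_def)
  finally show "coord (\<Sum>i<n. coord x i *\<^sub>R unit_fseq i) j = coord x j" .
qed

lemma span_units: "span (unit_fseq ` {..<n}) = Rn n"
proof
  have "subspace (Rn n)" by (auto simp: subspace_def Rn_def)
  moreover have "unit_fseq ` {..<n} \<subseteq> Rn n" by (auto simp: Rn_def coord_unit)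
  ultimately show "span (unit_fseq ` {..<n}) \<subseteq> Rn n" by (rule span_minimal[rotated])
  show "Rn n \<subseteq> span (unit_fseq ` {..<n})"
  proof
    fix x assume "x \<in> Rn n"
    from sum_coord_units[OF this, symmetric] show "x \<in> span (unit_fseq ` {..<n})"
      by (metis (no_types, lifting) imageI span_base span_scale span_sum)
  qed
qed

lemma inner_Rn:
  assumes "x \<in> Rn n"
  shows "x \<bullet> v = (\<Sum>i<n. coord x i * coord v i)"
  using assms by (intro inner_fseq_eq_sum) (auto simp: Rn_def not_less[symmetric])

text \<open>
  A small ball of the ambient subspace, which is a dilated translate of the unit ball, fits into
  \<open>K\<close>.
\<close>
lemma emeasure_convex_body_pos:
  assumes K: "convex_body n K" and B: "finite B" "orthonormal B" "span B = Rn n"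
  shows "0 < emeasure (lborel_span B) K"
proof -
  have Kb [measurable]: "K \<in> sets borel" using K by (intro borel_closed compact_imp_closed) (simp add: convex_body_def)
  obtain x U where U: "openin (top_of_set (Rn n)) U" "x \<in> U" "U \<subseteq> K"
    using K by (auto simp: convex_body_def interior_of_def)
  obtain T where T: "open T" "U = Rn n \<inter> T" using U(1) by (auto simp: openin_open)
  have xR: "x \<in> Rn n" using U T by auto
  obtain r where r: "0 < r" "cball x r \<subseteq> T" using T U open_contains_cball by blast
  let ?T = "\<lambda>w. \<lambda>b\<in>B. x \<bullet> b + r * w b"
  have KB: "{w \<in> space (leb B). lin_comb B w \<in> K} \<in> sets (leb B)"
    by (rule sets_Collect_preimage[OF measurable_lin_comb[OF B(1)] Kb])
  have "{w \<in> space (leb B). lin_comb B w \<in> cball 0 1}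
      \<subseteq> {w \<in> space (leb B). ?T w \<in> {w \<in> space (leb B). lin_comb B w \<in> K}}"
  proof
    fix w assume w: "w \<in> {w \<in> space (leb B). lin_comb B w \<in> cball 0 1}"
    have e: "lin_comb B (?T w) = x + r *\<^sub>R lin_comb B w"
      using lin_comb_expand[OF B(1,2), of x] B(3) xR by (simp add: lin_comb_add lin_comb_scale)
    have "lin_comb B (?T w) \<in> Rn n" using lin_comb_in_span[of B] B(3) by blast
    moreover have "lin_comb B (?T w) \<in> cball x r" unfolding e using w r(1) by (simp add: dist_norm)
    ultimately have "lin_comb B (?T w) \<in> K" using r(2) T(2) U(3) by auto
    then show "w \<in> {w \<in> space (leb B). ?T w \<in> {w \<in> space (leb B). lin_comb B w \<in> K}}" using w by (simp add: space_PiM)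
  qed
  then have "emeasure (leb B) {w \<in> space (leb B). lin_comb B w \<in> cball 0 1}
     \<le> emeasure (leb B) {w \<in> space (leb B). ?T w \<in> {w \<in> space (leb B). lin_comb B w \<in> K}}"
    by (rule emeasure_mono)
      (rule sets_Collect_preimage[OF measurable_leb_affine[of "\<lambda>j. j" B B] KB], simp add: bij_betw_def)
  moreover have "0 < emeasure (leb B) {w \<in> space (leb B). lin_comb B w \<in> cball 0 1}"
    using emeasure_unit_ball(2)[OF B(1,2)] emeasure_lborel_span[OF B(1), of "cball 0 1"] by simp
  ultimately have "0 < emeasure (leb B) {w \<in> space (leb B). ?T w \<in> {w \<in> space (leb B). lin_comb B w \<in> K}}"
    by (rule order_less_le_trans[rotated])
  moreover have "emeasure (leb B) {w \<in> space (leb B). lin_comb B w \<in> K}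
      = ennreal \<bar>r\<bar> ^ card B * emeasure (leb B) {w \<in> space (leb B). ?T w \<in> {w \<in> space (leb B). lin_comb B w \<in> K}}"
    using r(1) by (intro emeasure_leb_affine B(1) KB) (auto simp: bij_betw_def)
  moreover have "0 < ennreal \<bar>r\<bar> ^ card B" using r by (simp add: ennreal_power)
  ultimately show ?thesis using emeasure_lborel_span[OF B(1) Kb] by (simp add: ennreal_zero_less_mult_iff)
qed

text \<open>
  Since \<open>K\<close> has positive volume, the vanishing of the centroid means that of the coordinate
  integrals, and not that a division by \<open>0\<close> has occurred.
\<close>
lemma centroid_zero_imp:
  assumes K: "convex_body n K" and c: "centroid n K = 0" and B: "finite B" "orthonormal B" "span B = Rn n"
  shows "(\<integral>x. indicator K x * (x \<bullet> v) \<partial>lborel_span B) = 0"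
proof -
  let ?U = "unit_fseq ` {..<n}"
  let ?M = "lborel_span ?U"
  have MB: "lborel_span B = ?M"
    using B span_units[of n] orthonormal_units by (intro lborel_span_unique) auto
  have Kb [measurable]: "K \<in> sets borel" using K by (intro borel_closed compact_imp_closed) (simp add: convex_body_def)
  obtain R where R: "0 < R" "\<And>x. x \<in> K \<Longrightarrow> norm x \<le> R"
    using K compact_imp_bounded[of K] by (auto simp: convex_body_def bounded_pos)
  have Kfin: "emeasure ?M K < \<infinity>"
    using R orthonormal_units by (intro emeasure_lborel_span_bounded[where R = R]) auto
  have "0 < emeasure ?M K" using emeasure_convex_body_pos[OF K, of ?U] orthonormal_units span_units by simp
  then have Kpos: "measure ?M K \<noteq> 0" using Kfin by (simp add: measure_def enn2real_eq_0_iff less_top)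
  let ?I = "\<lambda>i. LINT x:K|?M. coord x i"
  have "(\<Sum>i<n. ?I i *\<^sub>R unit_fseq i) = 0"
    using c Kpos by (simp add: centroid_def Let_def)
  then have "(\<Sum>i<n. ?I i *\<^sub>R unit_fseq i) \<bullet> unit_fseq j = 0" for j by simp
  note units0 = this
  have I0: "?I j = 0" if "j < n" for j
  proof -
    have "0 = (\<Sum>i<n. ?I i * (if j = i then 1 else 0))"
      using units0[of j] unfolding inner_sum_left unfolding inner_scaleR_left unfolding inner_unit_fseq coord_unit ..
    also have "\<dots> = (\<Sum>i<n. if j = i then ?I i else 0)" by (intro sum.cong) auto
    also have "\<dots> = ?I j" using that by simp
    finally show ?thesis ..
  qed
  have int: "integrable ?M (\<lambda>x. indicator K x * coord x i)" for i
  proof -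
    have "(\<lambda>x. x \<bullet> unit_fseq i) \<in> borel_measurable borel" by (intro borel_measurable_continuous_onI continuous_intros)
    then have [measurable]: "(\<lambda>x. coord x i) \<in> borel_measurable borel" by (simp add: inner_unit_fseq)
    have "norm (coord x i) \<le> R" if "x \<in> K" for x
      using Cauchy_Schwarz_ineq2[of x "unit_fseq i"] R(2)[OF that] orthonormal_units[of "{i}"]
      by (simp add: inner_unit_fseq orthonormal_def)
    then have "integrable ?M (\<lambda>x. indicator K x *\<^sub>R coord x i)"
      using Kfin by (intro integrableI_bounded_set_indicator[where B = R]) auto
    then show ?thesis by simp
  qed
  have "(\<integral>x. indicator K x * (x \<bullet> v) \<partial>?M) = (\<integral>x. (\<Sum>i<n. indicator K x * coord x i * coord v i) \<partial>?M)"
  proof (rule Bochner_Integration.integral_cong[OF refl])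
    fix x
    show "indicator K x * (x \<bullet> v) = (\<Sum>i<n. indicator K x * coord x i * coord v i)"
      using K inner_Rn[of x n v] by (cases "x \<in> K") (auto simp: convex_body_def)
  qed
  also have "\<dots> = (\<Sum>i<n. ?I i * coord v i)"
    using int by (subst Bochner_Integration.integral_sum) (auto simp: set_lebesgue_integral_def)
  also have "\<dots> = 0" using I0 by simp
  finally show ?thesis by (simp add: MB)
qed

text \<open>
  The number \<open>W\<close> is the volume of the whole section of \<open>K\<close> by the span of \<open>F\<close> and \<open>\<eta>\<close>. The proof
  applies \<open>half_section_lower_bound\<close> to an orthonormal basis \<open>C\<close> of that
  span which contains \<open>\<eta>\<close>, completed to one of \<open>\<real>\<^sup>n\<close> by \<open>D\<close>.
\<close>
lemma grunbaum_section:
  assumes kn: "1 \<le> k" "k \<le> n" and K: "convex_body n K" and c: "centroid n K = 0"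
    and F: "F \<subseteq> Rn n" "subspace F" "dim F = n - k" and \<eta>: "\<eta> \<in> Rn n" "norm \<eta> = 1" "\<eta> \<in> F\<^sup>\<bottom>"
  obtains W where "(real (n - k + 1) / (real n + 1)) ^ (n - k + 1) * W \<le> vol (n - k + 1) (K \<inter> (F + pos_ray \<eta>))"
    "vol (n - k + 1) (K \<inter> (F + neg_ray \<eta>)) \<le> W"
proof -
  let ?U = "unit_fseq ` {..<n}"
  obtain BF where BF: "finite BF" "orthonormal BF" "span BF = F" "card BF = n - k"
    by (rule orthonormal_basis_exists[of F ?U]) (use F span_units in auto)
  have \<eta>F: "x \<bullet> \<eta> = 0" if "x \<in> F" for x
    using \<eta>(3) that by (auto simp: orthogonal_comp_def orthogonal_def)
  define C where "C = insert \<eta> BF"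
  have BFF: "BF \<subseteq> F" using BF(3) span_superset by auto
  have \<eta>n: "\<eta> \<notin> BF" using \<eta>F[of \<eta>] BFF \<eta>(2) by auto
  have C: "finite C" "card C = n - k + 1" "\<eta> \<in> C" using BF \<eta>n by (auto simp: C_def)
  have oC: "orthonormal C" using BF(2) \<eta>F BFF \<eta>(2)
    by (auto simp: C_def orthonormal_def pairwise_insert orthogonal_def inner_commute)
  have "C \<subseteq> span ?U" using BFF F(1) \<eta>(1) by (auto simp: C_def span_units)
  then obtain D where D: "finite D" "C \<inter> D = {}" "orthonormal (C \<union> D)" "span (C \<union> D) = span ?U"
    using orthonormal_extension_exists[OF C(1) oC, of ?U] by blast
  have cU: "card ?U = n" using inj_unit_fseq by (simp add: card_image inj_on_subset)
  have "card (C \<union> D) = n"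
    using orthonormal_card_eq[of "C \<union> D" ?U] C D orthonormal_units cU by simp
  then have cD: "card D + card C = n" using C D by (simp add: card_Un_disjoint)
  have Kc: "compact K" "convex K" "K \<subseteq> Rn n" using K by (auto simp: convex_body_def)
  interpret S: sliced_body C D K \<eta>
  proof
    show "0 < emeasure (lborel_span (C \<union> D)) K"
      using emeasure_convex_body_pos[OF K, of "C \<union> D"] C D span_units by simp
    show "(\<integral>x. indicator K x * (x \<bullet> v) \<partial>lborel_span (C \<union> D)) = 0" for v
      using centroid_zero_imp[OF K c, of "C \<union> D" v] C D span_units by simp
  qed (use C D Kc span_units in auto)
  have spC: "x \<in> span C \<longleftrightarrow> (\<exists>t. x - t *\<^sub>R \<eta> \<in> F)" for x
    using span_breakdown_eq[of x \<eta> BF] BF(3) by (simp add: C_def)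
  let ?E = "{x. lin_comb C (\<lambda>b. x \<bullet> b) = x}"
  have E: "span C = ?E"
    using lin_comb_expand[OF C(1) oC] lin_comb_in_span[of C] by (metis (mono_tags, lifting) Collect_cong Collect_mem_eq)
  have closedE: "closed (span C)" unfolding E lin_comb_def
    by (intro closed_Collect_eq continuous_intros)
  have pos: "K \<inter> (F + pos_ray \<eta>) = K \<inter> span C \<inter> {x. 0 \<le> x \<bullet> \<eta>}"
  proof (intro set_eqI iffI)
    fix x assume "x \<in> K \<inter> (F + pos_ray \<eta>)"
    then obtain f t where "x \<in> K" "f \<in> F" "0 \<le> t" "x = f + t *\<^sub>R \<eta>" by (auto simp: set_plus_def pos_ray_def)
    then show "x \<in> K \<inter> span C \<inter> {x. 0 \<le> x \<bullet> \<eta>}"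
      using \<eta>F[of f] \<eta>(2) by (auto simp: spC inner_add_left norm_eq_1 intro!: exI[of _ t])
  next
    fix x assume x: "x \<in> K \<inter> span C \<inter> {x. 0 \<le> x \<bullet> \<eta>}"
    then obtain t where t: "x - t *\<^sub>R \<eta> \<in> F" by (auto simp: spC)
    have "x \<bullet> \<eta> = t" using \<eta>F[OF t] \<eta>(2) by (simp add: inner_diff_left norm_eq_1)
    then have "0 \<le> t" using x by simp
    then show "x \<in> K \<inter> (F + pos_ray \<eta>)" using x t
      by (auto simp: set_plus_def pos_ray_def intro!: bexI[of _ "x - t *\<^sub>R \<eta>"])
  qed
  have neg: "K \<inter> (F + neg_ray \<eta>) \<subseteq> K \<inter> span C"
  proof
    fix x assume "x \<in> K \<inter> (F + neg_ray \<eta>)"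
    then obtain f t where "x \<in> K" "f \<in> F" "x = f + t *\<^sub>R \<eta>" by (auto simp: set_plus_def neg_ray_def)
    then show "x \<in> K \<inter> span C" by (auto simp: spC intro!: exI[of _ t])
  qed
  have clK: "closed K" using Kc by (simp add: compact_imp_closed)
  have E_borel: "K \<inter> span C \<in> sets borel" using clK closedE by (intro borel_closed closed_Int)
  have P_borel: "K \<inter> span C \<inter> {x. 0 \<le> x \<bullet> \<eta>} \<in> sets borel"
    using clK closedE by (intro borel_closed closed_Int closed_Collect_le continuous_intros)
  have vP: "vol (n - k + 1) (K \<inter> (F + pos_ray \<eta>)) = measure (leb C) (S.sect {0..} 0)"
  proof -
    have "vol (n - k + 1) (K \<inter> (F + pos_ray \<eta>)) = measure (lborel_span C) (K \<inter> span C \<inter> {x. 0 \<le> x \<bullet> \<eta>})"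
      unfolding C(2)[symmetric] pos by (rule vol_eq_measure[OF C(1) oC]) auto
    also have "\<dots> = measure (leb C) {w \<in> space (leb C). lin_comb C w \<in> K \<inter> span C \<inter> {x. 0 \<le> x \<bullet> \<eta>}}"
      using emeasure_lborel_span[OF C(1) P_borel] by (simp add: measure_def)
    also have "{w \<in> space (leb C). lin_comb C w \<in> K \<inter> span C \<inter> {x. 0 \<le> x \<bullet> \<eta>}} = S.sect {0..} 0"
      by (simp add: S.sect_def lin_comb_in_span lin_comb_inner[OF C(1) oC C(3)])
    finally show ?thesis .
  qed
  have vE: "measure (lborel_span C) (K \<inter> span C) = measure (leb C) (S.sect UNIV 0)"
    using emeasure_lborel_span[OF C(1) E_borel] by (simp add: measure_def S.sect_def lin_comb_in_span)
  have "vol (n - k + 1) (K \<inter> (F + neg_ray \<eta>)) \<le> measure (leb C) (S.sect UNIV 0)"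
  proof -
    have "vol (n - k + 1) (K \<inter> (F + neg_ray \<eta>)) = measure (lborel_span C) (K \<inter> (F + neg_ray \<eta>))"
      unfolding C(2)[symmetric] using neg by (intro vol_eq_measure[OF C(1) oC]) auto
    also have "\<dots> \<le> measure (lborel_span C) (K \<inter> span C)"
    proof (cases "K \<inter> (F + neg_ray \<eta>) \<in> sets (lborel_span C)")
      case True
      have "emeasure (lborel_span C) (K \<inter> span C) < \<infinity>"
        using S.R E_borel oC C by (intro emeasure_lborel_span_bounded[where R = S.R]) auto
      then show ?thesis using neg True E_borel by (intro measure_mono_fmeasurable) (auto simp: fmeasurable_def)
    qed (simp add: measure_notin_sets)
    finally show ?thesis unfolding vE .
  qed
  moreover have "(real (n - k + 1) / (real n + 1)) ^ (n - k + 1) * measure (leb C) (S.sect UNIV 0) \<le> vol (n - k + 1) (K \<inter> (F + pos_ray \<eta>))"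
    using S.half_section_lower_bound unfolding vP cD unfolding C(2) .
  ultimately show ?thesis using that by blast
qed

text \<open>
  The constant is \<open>4\<close>. With \<open>m = n - k + 1\<close> and \<open>q = 1 + k / m = (n + 1) / m\<close>, applying the previous
  bound to \<open>- \<theta>\<close> shows that the ratio is at most \<open>q ^ m\<close>. The exponent in the claim is \<open>m - 2\<close>, and
  the two missing factors \<open>q\<close> are paid for by \<open>q \<le> 2 * k\<close>. The second inequality is
  \<open>q ^ m \<le> exp k\<close>. If the denominator of the ratio is \<open>0\<close>, the quotient is \<open>0\<close> by convention.
\<close>
theorem corollary1:
  shows "\<exists>c::real. c > 0 \<and>
    (\<forall>(n::nat) (k::nat) (K::fseq set) (F::fseq set) (\<theta>::fseq).
       1 \<le> k \<longrightarrow> k \<le> n \<longrightarrow>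
       convex_body n K \<longrightarrow> centroid n K = 0 \<longrightarrow>
       F \<subseteq> Rn n \<longrightarrow> subspace F \<longrightarrow> dim F = n - k \<longrightarrow>
       \<theta> \<in> Rn n \<inter> sphere 0 1 \<inter> F\<^sup>\<bottom> \<longrightarrow>
         vol (n - k + 1) (K \<inter> (F + pos_ray \<theta>)) / vol (n - k + 1) (K \<inter> (F + neg_ray \<theta>))
           \<le> c * real k ^ 2 * (1 + real k / (real n - real k + 1)) powi (int n - int k - 1) \<and>
         c * real k ^ 2 * (1 + real k / (real n - real k + 1)) powi (int n - int k - 1)
           \<le> c * (real k * (real n + 1 - real k) / (real n + 1)) ^ 2 * exp (real k))"
proof (intro exI[of _ 4] conjI allI impI)
  fix n k :: nat and K F :: "fseq set" and \<theta> :: fseq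
  assume kn: "1 \<le> k" "k \<le> n"
  define m where "m = n - k + 1"
  define q where "q = 1 + real k / real m"
  have m: "real n - real k + 1 = real m" "real n + 1 - real k = real m" "int n - int k - 1 = int m - 2" "1 \<le> m"
    "real n + 1 = real m + real k"
    using kn by (auto simp: m_def)
  have q1: "1 < q" using kn m by (simp add: q_def)
  have qm: "(real m + real k) / real m = q" using m by (simp add: q_def field_simps)
  have powi: "q powi (int m - 2) = q ^ m / q ^ 2"
    using q1 by (simp add: power_int_diff)
  {
    have "q ^ m \<le> exp (real k / real m) ^ m" unfolding q_def by (intro power_mono exp_ge_add_one_self) simp
    also have "\<dots> = exp (real k)" using m by (simp flip: exp_of_nat_mult)
    finally have "4 * real k ^ 2 * (q ^ m / q ^ 2) \<le> 4 * real k ^ 2 * (exp (real k) / q ^ 2)"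
      by (intro mult_left_mono divide_right_mono) auto
    also have "\<dots> = 4 * (real k * real m / (real n + 1)) ^ 2 * exp (real k)"
      unfolding m(5) qm[symmetric] using m by (simp add: power_divide power_mult_distrib)
    finally show "4 * real k ^ 2 * (1 + real k / (real n - real k + 1)) powi (int n - int k - 1)
       \<le> 4 * (real k * (real n + 1 - real k) / (real n + 1)) ^ 2 * exp (real k)"
      unfolding m(1-3) q_def[symmetric] powi .
  }
  assume K: "convex_body n K" "centroid n K = 0" and F: "F \<subseteq> Rn n" "subspace F" "dim F = n - k"
    and \<theta>: "\<theta> \<in> Rn n \<inter> sphere 0 1 \<inter> F\<^sup>\<bottom>"
  \<comment> \<open>the half in direction \<open>- \<theta>\<close> is the denominator, which has to be bounded from below\<close>
  have "- \<theta> \<in> Rn n" "norm (- \<theta>) = 1" "- \<theta> \<in> F\<^sup>\<bottom>"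
    using \<theta> by (auto simp: Rn_def orthogonal_comp_def orthogonal_def)
  then obtain W where W: "(real m / (real n + 1)) ^ m * W \<le> vol m (K \<inter> (F + pos_ray (- \<theta>)))"
    "vol m (K \<inter> (F + neg_ray (- \<theta>))) \<le> W"
    unfolding m_def by (rule grunbaum_section[OF kn K F])
  have rays: "pos_ray (- \<theta>) = neg_ray \<theta>" "neg_ray (- \<theta>) = pos_ray \<theta>"
    unfolding pos_ray_def neg_ray_def
    by (auto intro: exI[of _ "- t" for t])
  define P where "P = vol m (K \<inter> (F + pos_ray \<theta>))"
  define N where "N = vol m (K \<inter> (F + neg_ray \<theta>))"
  have N0: "0 \<le> N" by (simp add: N_def vol_def)
  have PW: "P \<le> W" using W(2) by (simp add: P_def rays)
  have NW: "W \<le> q ^ m * N"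
  proof -
    have "(1 / q) ^ m * W \<le> N" using W(1) m(4) unfolding N_def rays m(5) qm[symmetric] by simp
    then show ?thesis using q1 by (simp add: power_divide field_simps)
  qed
  have "P / N \<le> q ^ m"
  proof (cases "N = 0")
    case False
    then show ?thesis using N0 PW NW by (simp add: pos_divide_le_eq)
  qed (use q1 in simp)
  also have "q ^ m = q ^ 2 * (q ^ m / q ^ 2)" using q1 by simp
  also have "\<dots> \<le> (4 * real k ^ 2) * (q ^ m / q ^ 2)"
  proof (rule mult_right_mono)
    have "real k / real m \<le> real k / 1" using m(4) by (intro divide_left_mono) auto
    then have "q \<le> 2 * real k" using kn by (simp add: q_def)
    then have "q ^ 2 \<le> (2 * real k) ^ 2" using q1 by (intro power_mono) auto
    then show "q ^ 2 \<le> 4 * real k ^ 2" by (simp add: power_mult_distrib)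
  qed (use q1 in simp)
  finally show "vol (n - k + 1) (K \<inter> (F + pos_ray \<theta>)) / vol (n - k + 1) (K \<inter> (F + neg_ray \<theta>))
       \<le> 4 * real k ^ 2 * (1 + real k / (real n - real k + 1)) powi (int n - int k - 1)"
    unfolding m(1-3) q_def[symmetric] powi m_def[symmetric] P_def N_def .
qed simp

end
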